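(* Let $m\ge4$, let $\mathcal W_1$ be an $m\times m$ quadrilateral labyrinth set in $Q$, and let $L_\infty$ be the associated quadrilateral labyrinth fractal. Then $L_\infty$ is a dendrite, i.e. a locally connected continuum (nonempty compact connected Hausdorff space) containing no simple closed curve.
   Context: Let $Q$ be a convex quadrilateral in $\mathbb{R}^2$. Divide $Q$ into two triangles by its shorter diagonal (either diagonal if they have equal length). Label the vertices $Q_1,Q_2,Q_3,Q_4$ anticlockwise, starting at an endpoint of that diagonal, so that the diagonal is $Q_1Q_3$. Let $\Delta_1$ be the closed triangle $Q_1Q_2Q_3$ and $\Delta_2$ the closed triangle $Q_3Q_4Q_1$. Every $x\in Q$ has a unique representation $x=\sum_{i=1}^4\alpha_iQ_i$, defined as follows. If $x\in\Delta_1$, then $\alpha_4=0$ and $(\alpha_1,\alpha_2,\alpha_3)$ are the barycentric coordinates of $x$ in $\Delta_1$. If $x\in\Delta_2$, then $\alpha_2=0$ and $(\alpha_1,\alpha_3,\alpha_4)$ are the barycentric coordinates of $x$ in $\Delta_2$. For an ordered quadruple $V=(V_1,\dots,V_4)$ define $P_V:Q\to\mathbb{R}^2$ by $P_V(x)=\sum_i\alpha_iV_i$. For an integer $m\ge2$, define the following index sets: - $A_1=\{(k_1,k_2,k_3,0)\in\mathbb{Z}_{\ge0}^4:k_1+k_2+k_3=m-1,\ k_2\ne0\}$, - $A_2=\{(k_1,0,k_3,k_4)\in\mathbb{Z}_{\ge0}^4:k_1+k_3+k_4=m-1,\ k_4\ne0\}$, - $A_3=\{(k_1,0,k_3,0)\in\mathbb{Z}_{\ge0}^4:k_1+k_3=m-1\}$,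 - $A=A_1\cup A_2\cup A_3$. For $k\in A$, let $S_m(k)$ be the quadrilateral with ordered vertices $R_1R_2R_3R_4$ given below. - If $k\in A_1$: $R_1=\frac{(k_1+1)Q_1+k_2Q_2+k_3Q_3}{m}$, $R_2=\frac{k_1Q_1+(k_2+1)Q_2+k_3Q_3}{m}$, $R_3=\frac{k_1Q_1+k_2Q_2+(k_3+1)Q_3}{m}$, $R_4=\frac{(k_1+1)Q_1+(k_2-1)Q_2+(k_3+1)Q_3}{m}$. - If $k\in A_2$: $R_1=\frac{(k_1+1)Q_1+k_3Q_3+k_4Q_4}{m}$, $R_2=\frac{(k_1+1)Q_1+(k_3+1)Q_3+(k_4-1)Q_4}{m}$, $R_3=\frac{k_1Q_1+(k_3+1)Q_3+k_4Q_4}{m}$, $R_4=\frac{k_1Q_1+k_3Q_3+(k_4+1)Q_4}{m}$. - If $k\in A_3$: $R_1=\frac{(k_1+1)Q_1+k_3Q_3}{m}$, $R_2=\frac{k_1Q_1+Q_2+k_3Q_3}{m}$, $R_3=\frac{k_1Q_1+(k_3+1)Q_3}{m}$, $R_4=\frac{k_1Q_1+k_3Q_3+Q_4}{m}$. Let $\mathcal S_m=\{S_m(k):k\in A\}$. For $\mathcal W\subseteq\mathcal S_m$, the graph $\mathcal G(\mathcal W)$ has vertex set $\mathcal W$, with two elements adjacent iff they have a common side. An $m\times m$ quadrilateral labyrinth set ($m\ge4$) is a set $\mathcal W_1\subseteq\mathcal S_m$ satisfying three properties. (1) Tree property: $\mathcal G(\mathcal W_1)$ is a tree. (2) Exit property: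 there is exactly one $(k_1,k_2,0,0)\in A$ with $S_m(k_1,k_2,0,0)\in\mathcal W_1$ and $S_m(0,0,k_2,k_1)\in\mathcal W_1$. There is also exactly one $(k_1,0,0,k_4)\in A$ with $S_m(k_1,0,0,k_4)\in\mathcal W_1$ and $S_m(0,k_1,k_4,0)\in\mathcal W_1$. (3) Corner property: $\mathcal W_1$ contains at most one element of $\{S_m(m-1,0,0,0),S_m(0,0,m-1,0)\}$ and at most one element of $\{S_m(0,m-1,0,0),S_m(0,0,0,m-1)\}$. Define recursively for $n\ge2$: $\mathcal W_n=\{P_{W}(W'):W'\in\mathcal W_1,\ W\in\mathcal W_{n-1}\}$. Here $P_W(W')$ is the quadrilateral whose ordered vertices are the images under $P_W$ of the ordered vertices of $W'$. Let $L_n=\bigcup_{W\in\mathcal W_n}W$ (closed regions). The quadrilateral labyrinth fractal is $L_\infty=\bigcap_{n\ge1}L_n$, with the subspace topology from $\mathbb{R}^2$. *)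

theory Defs
  imports "HOL-Analysis.Analysis"
begin

type_synonym pt = "real^2"

text \<open>A quadrilateral given by its ordered vertices.\<close>
type_synonym quad = "pt \<times> pt \<times> pt \<times> pt"

definition cross2 :: "pt \<Rightarrow> pt \<Rightarrow> real" where
  "cross2 u v = u$1 * v$2 - u$2 * v$1"

text \<open>Vertices q1 q2 q3 q4 form a (non-degenerate) convex quadrilateral, listed anticlockwise.\<close>
definition convex_quad_ccw :: "quad \<Rightarrow> bool" where
  "convex_quad_ccw q \<longleftrightarrow> (case q of (a,b,c,d) \<Rightarrow>
      cross2 (b-a) (c-b) > 0 \<and> cross2 (c-b) (d-c) > 0 \<and>
      cross2 (d-c) (a-d) > 0 \<and> cross2 (a-d) (b-a) > 0)"

text \<open>The diagonal Q1Q3 is a shorter (or equal) diagonal.\<close>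
definition shorter_diag_13 :: "quad \<Rightarrow> bool" where
  "shorter_diag_13 q \<longleftrightarrow> (case q of (a,b,c,d) \<Rightarrow> dist a c \<le> dist b d)"

text \<open>Closed region bounded by the quadrilateral (all quadrilaterals occurring are convex).\<close>
definition quad_region :: "quad \<Rightarrow> pt set" where
  "quad_region q = (case q of (a,b,c,d) \<Rightarrow> convex hull {a,b,c,d})"

definition quad_sides :: "quad \<Rightarrow> pt set set" where
  "quad_sides q = (case q of (a,b,c,d) \<Rightarrow>
     {closed_segment a b, closed_segment b c, closed_segment c d, closed_segment d a})"

text \<open>The coordinates alpha of a point x of Q.\<close>
definition qcoords :: "quad \<Rightarrow> pt \<Rightarrow> real \<times> real \<times> real \<times> real" where
  "qcoords Q x = (case Q of (q1,q2,q3,q4) \<Rightarrow>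
     if x \<in> convex hull {q1,q2,q3} then
       (THE al. case al of (a1,a2,a3,a4) \<Rightarrow> a4 = 0 \<and> a1 \<ge> 0 \<and> a2 \<ge> 0 \<and> a3 \<ge> 0 \<and>
           a1 + a2 + a3 = 1 \<and> x = a1 *\<^sub>R q1 + a2 *\<^sub>R q2 + a3 *\<^sub>R q3)
     else
       (THE al. case al of (a1,a2,a3,a4) \<Rightarrow> a2 = 0 \<and> a1 \<ge> 0 \<and> a3 \<ge> 0 \<and> a4 \<ge> 0 \<and>
           a1 + a3 + a4 = 1 \<and> x = a1 *\<^sub>R q1 + a3 *\<^sub>R q3 + a4 *\<^sub>R q4))"

text \<open>P_V (relative to the fixed quadrilateral Q).\<close>
definition Pmap :: "quad \<Rightarrow> quad \<Rightarrow> pt \<Rightarrow> pt" where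
  "Pmap Q V x = (case qcoords Q x of (a1,a2,a3,a4) \<Rightarrow> case V of (v1,v2,v3,v4) \<Rightarrow>
      a1 *\<^sub>R v1 + a2 *\<^sub>R v2 + a3 *\<^sub>R v3 + a4 *\<^sub>R v4)"

text \<open>P_W(W'): apply P_W to the ordered vertices of W'.\<close>
definition Pquad :: "quad \<Rightarrow> quad \<Rightarrow> quad \<Rightarrow> quad" where
  "Pquad Q W W' = (case W' of (r1,r2,r3,r4) \<Rightarrow>
      (Pmap Q W r1, Pmap Q W r2, Pmap Q W r3, Pmap Q W r4))"

definition A1 :: "nat \<Rightarrow> (nat \<times> nat \<times> nat \<times> nat) set" where
  "A1 m = {(k1,k2,k3,k4). k4 = 0 \<and> k1 + k2 + k3 = m - 1 \<and> k2 \<noteq> 0}"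

definition A2 :: "nat \<Rightarrow> (nat \<times> nat \<times> nat \<times> nat) set" where
  "A2 m = {(k1,k2,k3,k4). k2 = 0 \<and> k1 + k3 + k4 = m - 1 \<and> k4 \<noteq> 0}"

definition A3 :: "nat \<Rightarrow> (nat \<times> nat \<times> nat \<times> nat) set" where
  "A3 m = {(k1,k2,k3,k4). k2 = 0 \<and> k4 = 0 \<and> k1 + k3 = m - 1}"

definition Aidx :: "nat \<Rightarrow> (nat \<times> nat \<times> nat \<times> nat) set" where
  "Aidx m = A1 m \<union> A2 m \<union> A3 m"

text \<open>S_m(k) (only meaningful for k in Aidx m).\<close>
definition Sm :: "quad \<Rightarrow> nat \<Rightarrow> nat \<times> nat \<times> nat \<times> nat \<Rightarrow> quad" where
  "Sm Q m k = (case Q of (q1,q2,q3,q4) \<Rightarrow> case k of (k1,k2,k3,k4) \<Rightarrow>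
     let c = (\<lambda>a1 a2 a3 a4. (1 / real m) *\<^sub>R (a1 *\<^sub>R q1 + a2 *\<^sub>R q2 + a3 *\<^sub>R q3 + a4 *\<^sub>R q4))
     in if k \<in> A1 m then
          (c (real k1 + 1) (real k2) (real k3) 0, c (real k1) (real k2 + 1) (real k3) 0,
           c (real k1) (real k2) (real k3 + 1) 0, c (real k1 + 1) (real k2 - 1) (real k3 + 1) 0)
        else if k \<in> A2 m then
          (c (real k1 + 1) 0 (real k3) (real k4), c (real k1 + 1) 0 (real k3 + 1) (real k4 - 1),
           c (real k1) 0 (real k3 + 1) (real k4), c (real k1) 0 (real k3) (real k4 + 1))
        else
          (c (real k1 + 1) 0 (real k3) 0, c (real k1) 1 (real k3) 0,
           c (real k1) 0 (real k3 + 1) 0, c (real k1) 0 (real k3) 1))"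

definition S_set :: "quad \<Rightarrow> nat \<Rightarrow> quad set" where
  "S_set Q m = Sm Q m ` Aidx m"

text \<open>Adjacency in G(W): distinct elements with a common side.\<close>
definition quad_adj :: "quad \<Rightarrow> quad \<Rightarrow> bool" where
  "quad_adj W W' \<longleftrightarrow> W \<noteq> W' \<and> quad_sides W \<inter> quad_sides W' \<noteq> {}"

text \<open>Elementary graph notions for a vertex set V with symmetric adjacency E.\<close>
definition graph_connected :: "'a set \<Rightarrow> ('a \<Rightarrow> 'a \<Rightarrow> bool) \<Rightarrow> bool" where
  "graph_connected V E \<longleftrightarrow>
     (\<forall>x\<in>V. \<forall>y\<in>V. (x, y) \<in> {(a, b). a \<in> V \<and> b \<in> V \<and> E a b}\<^sup>*)"

definition graph_cycle :: "'a set \<Rightarrow> ('a \<Rightarrow> 'a \<Rightarrow> bool) \<Rightarrow> 'a list \<Rightarrow> bool" where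
  "graph_cycle V E cs \<longleftrightarrow> length cs \<ge> 3 \<and> distinct cs \<and> set cs \<subseteq> V \<and>
     (\<forall>i < length cs. E (cs ! i) (cs ! ((i + 1) mod length cs)))"

definition graph_tree :: "'a set \<Rightarrow> ('a \<Rightarrow> 'a \<Rightarrow> bool) \<Rightarrow> bool" where
  "graph_tree V E \<longleftrightarrow> finite V \<and> V \<noteq> {} \<and> graph_connected V E \<and> \<not> (\<exists>cs. graph_cycle V E cs)"

definition quad_labyrinth_set :: "quad \<Rightarrow> nat \<Rightarrow> quad set \<Rightarrow> bool" where
  "quad_labyrinth_set Q m W \<longleftrightarrow> 4 \<le> m \<and> W \<subseteq> S_set Q m \<and>
     graph_tree W quad_adj \<and>
     (\<exists>!p. case p of (k1, k2) \<Rightarrow>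
        (k1, k2, 0, 0) \<in> Aidx m \<and> Sm Q m (k1, k2, 0, 0) \<in> W \<and>
        (0, 0, k2, k1) \<in> Aidx m \<and> Sm Q m (0, 0, k2, k1) \<in> W) \<and>
     (\<exists>!p. case p of (k1, k4) \<Rightarrow>
        (k1, 0, 0, k4) \<in> Aidx m \<and> Sm Q m (k1, 0, 0, k4) \<in> W \<and>
        (0, k1, k4, 0) \<in> Aidx m \<and> Sm Q m (0, k1, k4, 0) \<in> W) \<and>
     \<not> (Sm Q m (m - 1, 0, 0, 0) \<in> W \<and> Sm Q m (0, 0, m - 1, 0) \<in> W) \<and>
     \<not> (Sm Q m (0, m - 1, 0, 0) \<in> W \<and> Sm Q m (0, 0, 0, m - 1) \<in> W)"

text \<open>lab_W Q W1 n is the set W_(n+1) of the paper.\<close>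
primrec lab_W :: "quad \<Rightarrow> quad set \<Rightarrow> nat \<Rightarrow> quad set" where
  "lab_W Q W1 0 = W1"
| "lab_W Q W1 (Suc n) = {Pquad Q W W' | W W'. W' \<in> W1 \<and> W \<in> lab_W Q W1 n}"

definition lab_L :: "quad \<Rightarrow> quad set \<Rightarrow> nat \<Rightarrow> pt set" where
  "lab_L Q W1 n = \<Union> (quad_region ` lab_W Q W1 n)"

definition lab_fractal :: "quad \<Rightarrow> quad set \<Rightarrow> pt set" where
  "lab_fractal Q W1 = (\<Inter>n. lab_L Q W1 n)"

text \<open>Dendrite: locally connected continuum containing no simple closed curve.\<close>
definition dendrite :: "pt set \<Rightarrow> bool" where
  "dendrite S \<longleftrightarrow> S \<noteq> {} \<and> compact S \<and> connected S \<and> locally connected S \<and>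
     \<not> (\<exists>C. C \<subseteq> S \<and> C homeomorphic sphere (0::pt) 1)"

end

theory Submission
  imports Defs
begin

text \<open>The piecewise affine bijection \<open>quad_map Q\<close> from the unit square onto \<open>Q\<close>, affine on both
  sides of the diagonal, turns the quadrilaterals \<open>S\<^sub>m(k)\<close> into the cells of the \<open>m \<times> m\<close> grid
  and the maps \<open>P\<^sub>W\<close> into similarities of the plane. Hence the fractal is homeomorphic to the
  attractor \<open>F\<close> of finitely many similarities \<open>f\<^sub>k\<close> of ratio \<open>1/m\<close>. By the corner property pieces
  \<open>f\<^sub>k(F)\<close> of diagonally touching cells are disjoint; by the exit property those of neighbouring
  cells share exactly one point. So the pieces meet along a tree, in single points. The
  tree being connected makes \<open>F\<close> chain connected, hence connected, and a finite union of
  connected sets of arbitrarily small diameter, hence locally connected. Since the tree has no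
  cycles, a connected set without cut points has to lie in a single piece, then in a single
  piece of that piece, and so on; it is therefore at most a point, and not a circle.\<close>

section \<open>Self-similar sets with a tree of one-point intersections\<close>

lemma graph_cycle_mono: "graph_cycle U E cs \<Longrightarrow> U \<subseteq> V \<Longrightarrow> graph_cycle V E cs"
  by (auto simp: graph_cycle_def)

text \<open>Longest-path argument: otherwise the first vertex of a longest path has a further
  neighbour, which either prolongs the path or closes a cycle. A leaf may have no neighbour at all,
  because the lemma is applied to induced subgraphs of a tree, which can be disconnected.\<close>

lemma acyclic_graph_has_leaf:
  assumes fin: "finite V" and ne: "V \<noteq> {}" and sym: "\<And>a b. E a b \<Longrightarrow> E b a"
    and acyc: "\<nexists>cs. graph_cycle V E cs"
  shows "\<exists>v\<in>V. \<forall>a\<in>V - {v}. \<forall>b\<in>V - {v}. E v a \<longrightarrow> E v b \<longrightarrow> a = b"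
proof (rule ccontr)
  assume "\<not> ?thesis"
  then have two: "\<exists>a b. a \<in> V - {v} \<and> b \<in> V - {v} \<and> E v a \<and> E v b \<and> a \<noteq> b" if "v \<in> V" for v
    using that by blast
  define is_path where "is_path p \<longleftrightarrow> p \<noteq> [] \<and> distinct p \<and> set p \<subseteq> V \<and>
    (\<forall>i. Suc i < length p \<longrightarrow> E (p ! i) (p ! Suc i))" for p
  obtain v0 where "v0 \<in> V" using ne by blast
  then have "is_path [v0]" by (simp add: is_path_def)
  moreover have "\<forall>p. is_path p \<longrightarrow> length p < Suc (card V)"
  proof (intro allI impI)
    fix p assume "is_path p"
    then have "distinct p" "set p \<subseteq> V" by (simp_all add: is_path_def)
    then show "length p < Suc (card V)" using card_mono[OF fin, of "set p"] by (simp add: distinct_card)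
  qed
  ultimately have "\<exists>p. is_path p \<and> (\<forall>q. is_path q \<longrightarrow> length q \<le> length p)"
    by (rule ex_has_greatest_nat)
  then obtain p where p: "is_path p" and max: "\<And>q. is_path q \<Longrightarrow> length q \<le> length p"
    by blast
  define v where "v = p ! 0"
  have "v \<in> V" using p by (auto simp: is_path_def v_def)
  \<comment> \<open>If the path has only one vertex, \<open>p ! 1\<close> is an unspecified value;
    of two distinct neighbours at least one differs from it in any case.\<close>
  then obtain a where a: "a \<in> V" "a \<noteq> v" "E v a" "a \<noteq> p ! 1" using two[of v] by blast
  show False
  proof (cases "a \<in> set p")
    case False
    have "is_path (a # p)"
      unfolding is_path_def
    proof (intro conjI allI impI)
      fix i assume "Suc i < length (a # p)"
      then show "E ((a # p) ! i) ((a # p) ! Suc i)"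
        using p a sym by (cases i) (auto simp: is_path_def v_def)
    qed (use p a False in \<open>auto simp: is_path_def\<close>)
    then show False using max[of "a # p"] by simp
  next
    case True
    then obtain k where k: "k < length p" "p ! k = a" by (auto simp: in_set_conv_nth)
    have "k \<noteq> 0" "k \<noteq> 1" using a(2,4) k(2) unfolding v_def by metis+
    then have k2: "2 \<le> k" by simp
    \<comment> \<open>The stretch of the path from \<open>v\<close> to \<open>a\<close>, closed by
      the edge between them; by \<open>k2\<close> it has at least three vertices.\<close>
    let ?cs = "take (Suc k) p"
    have len: "length ?cs = Suc k" using k by simp
    have "E (?cs ! i) (?cs ! ((i + 1) mod length ?cs))" if "i < length ?cs" for i
    proof (cases "i = k")
      case True
      then show ?thesis using k a(3) sym by (simp add: len v_def)
    next
      case False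
      then show ?thesis using that p len by (auto simp: is_path_def)
    qed
    moreover have "length ?cs \<ge> 3" "distinct ?cs" "set ?cs \<subseteq> V"
      using k k2 p by (auto simp: is_path_def min_def dest: in_set_takeD)
    ultimately have "graph_cycle V E ?cs" unfolding graph_cycle_def by blast
    then show False using acyc by blast
  qed
qed

section \<open>Connectedness from chains, local connectedness from small pieces\<close>

text \<open>The two parts of a separation of a compact set have a positive distance
  \<open>d\<close>, and a chain with steps shorter than \<open>d\<close> cannot pass from one part
  to the other.\<close>

lemma chain_connected_imp_connected:
  fixes S :: "'a::heine_borel set"
  assumes "compact S"
    and chain: "\<And>e x y. e > 0 \<Longrightarrow> x \<in> S \<Longrightarrow> y \<in> S \<Longrightarrow>
      (x, y) \<in> {(a, b). a \<in> S \<and> b \<in> S \<and> dist a b < e}\<^sup>*"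
  shows "connected S"
proof (rule ccontr)
  assume "\<not> connected S"
  then obtain A B where AB: "closed A" "closed B" "A \<noteq> {}" "B \<noteq> {}" "A \<union> B = S" "A \<inter> B = {}"
    using connected_closed_set[of S] compact_imp_closed[OF \<open>compact S\<close>] by blast
  have "compact A"
    using AB \<open>compact S\<close> by (metis Un_upper1 compact_Int_closed inf.absorb_iff2)
  then obtain d where d: "d > 0" "\<And>x y. x \<in> A \<Longrightarrow> y \<in> B \<Longrightarrow> d \<le> dist x y"
    using separate_compact_closed[of A B] AB by blast
  obtain a b where ab: "a \<in> A" "b \<in> B" using AB by blast
  have "(a, b) \<in> {(a, b). a \<in> S \<and> b \<in> S \<and> dist a b < d}\<^sup>*"
    using chain[OF d(1)] ab AB by blast
  then have "b \<in> A"
  proof (induction rule: rtrancl_induct)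
    case base show ?case by (rule ab)
  next
    case (step y z)
    then show ?case using d(2)[of y z] AB by fastforce
  qed
  then show False using ab AB by blast
qed

text \<open>Removing the finitely many closed pieces that miss \<open>x\<close> leaves a
  neighbourhood of \<open>x\<close> in \<open>S\<close>. Each point of it shares a piece with
  \<open>x\<close>, and that piece is connected and too small to leave \<open>V\<close>.\<close>

lemma locally_connected_small_pieces:
  fixes S :: "'a::metric_space set"
  assumes pieces: "\<And>e. e > 0 \<Longrightarrow> \<exists>\<P>. finite \<P> \<and> \<Union>\<P> = S \<and>
    (\<forall>P\<in>\<P>. closed P \<and> connected P \<and> (\<forall>x\<in>P. \<forall>y\<in>P. dist x y < e))"
  shows "locally connected S"
  unfolding locally_connected_im_kleinen
proof (intro allI impI, elim conjE)
  fix V x assume V: "openin (top_of_set S) V" and x: "x \<in> V"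
  obtain e where e: "e > 0" "\<And>y. y \<in> S \<Longrightarrow> dist y x < e \<Longrightarrow> y \<in> V"
    using V x unfolding openin_euclidean_subtopology_iff by blast
  obtain \<P> where \<P>: "finite \<P>" "\<Union>\<P> = S"
    "\<And>P. P \<in> \<P> \<Longrightarrow> closed P \<and> connected P \<and> (\<forall>x\<in>P. \<forall>y\<in>P. dist x y < e)"
    using pieces[OF e(1)] by blast
  define K where "K = \<Union>{P \<in> \<P>. x \<notin> P}"
  have "closed K" unfolding K_def using \<P> by (intro closed_Union) auto
  have xS: "x \<in> S" using V x openin_subset by fastforce
  have near: "\<exists>P\<in>\<P>. x \<in> P \<and> y \<in> P \<and> P \<subseteq> V" if y: "y \<in> S - K" for y
  proof -
    obtain P where P: "P \<in> \<P>" "y \<in> P" using y \<P>(2) by blast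
    have "x \<in> P" using y P unfolding K_def by blast
    moreover have "P \<subseteq> V"
    proof
      fix z assume "z \<in> P"
      then show "z \<in> V" using e(2)[of z] \<P>(2) \<P>(3)[OF P(1)] \<open>x \<in> P\<close> P(1) by blast
    qed
    ultimately show ?thesis using P by blast
  qed
  have "openin (top_of_set S) (S - K)"
    using \<open>closed K\<close> by (simp add: Diff_eq openin_open_Int open_Compl)
  moreover have "x \<in> S - K" using xS by (auto simp: K_def)
  moreover have "S - K \<subseteq> V" using near by blast
  moreover have "\<forall>y. y \<in> S - K \<longrightarrow> (\<exists>C. connected C \<and> C \<subseteq> V \<and> x \<in> C \<and> y \<in> C)"
    using near \<P>(3) by blast
  ultimately show "\<exists>U. openin (top_of_set S) U \<and> x \<in> U \<and> U \<subseteq> V \<and>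
      (\<forall>y. y \<in> U \<longrightarrow> (\<exists>C. connected C \<and> C \<subseteq> V \<and> x \<in> C \<and> y \<in> C))" by blast
qed

section \<open>Sets without cut points\<close>

text \<open>The invariant that tells a circle from a subset of a dendrite; it survives injective
  continuous maps. The empty set and singletons have it, while the clause on \<open>C\<close> itself
  excludes discrete pairs of points.\<close>

definition no_cut_point :: "'a::topological_space set \<Rightarrow> bool" where
  "no_cut_point C \<longleftrightarrow> connected C \<and> (\<forall>p\<in>C. connected (C - {p}))"

lemma no_cut_point_image:
  assumes "no_cut_point C" "continuous_on C g" "inj_on g C"
  shows "no_cut_point (g ` C)"
  unfolding no_cut_point_def
proof (intro conjI ballI)
  show "connected (g ` C)"
    using assms connected_continuous_image no_cut_point_def by blast
  fix q assume "q \<in> g ` C"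
  then obtain p where p: "p \<in> C" "q = g p" by blast
  have "g ` C - {q} = g ` (C - {p})" using p assms(3) by (auto dest: inj_onD)
  moreover have "connected (g ` (C - {p}))"
    using assms p by (intro connected_continuous_image)
      (auto simp: no_cut_point_def intro: continuous_on_subset)
  ultimately show "connected (g ` C - {q})" by simp
qed

text \<open>By stereographic projection a punctured circle is a line.\<close>

lemma no_cut_point_circle: "no_cut_point (sphere (0::pt) 1)"
  unfolding no_cut_point_def
proof (intro conjI ballI)
  show "connected (sphere (0::pt) 1)" by (rule connected_sphere) simp
  fix p :: pt assume p: "p \<in> sphere 0 1"
  then have "p \<noteq> 0" by auto
  have "(sphere 0 1 - {p}) homeomorphic {x. p \<bullet> x = 0}"
    by (rule homeomorphic_punctured_sphere_hyperplane) (use p \<open>p \<noteq> 0\<close> in auto)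
  then show "connected (sphere 0 1 - {p})"
    using homeomorphic_connectedness convex_connected convex_hyperplane by blast
qed

text \<open>Two closed sets with at most one common point can only be joined through that point,
  which would be a cut point.\<close>
lemma no_cut_point_subset_cases:
  fixes C :: "'a::t1_space set"
  assumes C: "no_cut_point C" "C \<subseteq> A \<union> B" and cl: "closed A" "closed B"
    and one: "\<And>x y. x \<in> A \<inter> B \<Longrightarrow> y \<in> A \<inter> B \<Longrightarrow> x = y"
  shows "C \<subseteq> A \<or> C \<subseteq> B"
proof -
  have split: "D \<subseteq> A \<or> D \<subseteq> B" if "connected D" "D \<subseteq> C" "A \<inter> B \<inter> D = {}" for D
    using connected_closedD[OF that(1), of A B] cl C(2) that by blast
  show ?thesis
  proof (cases "A \<inter> B \<inter> C = {}")
    case True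
    then show ?thesis using split[of C] C by (simp add: no_cut_point_def)
  next
    case False
    then obtain p where p: "p \<in> A" "p \<in> B" "p \<in> C" by blast
    have "C - {p} \<subseteq> A \<or> C - {p} \<subseteq> B"
      using split[of "C - {p}"] C(1) p one by (auto simp: no_cut_point_def)
    then show ?thesis using p by blast
  qed
qed

lemma le_0_if_le_geometric:
  fixes d c D :: real
  assumes "0 < c" "c < 1" "\<And>n. d \<le> c ^ n * D"
  shows "d \<le> 0"
proof (rule LIMSEQ_le_const)
  have "(\<lambda>n. c ^ n * D) \<longlonglongrightarrow> 0 * D"
    using assms by (intro tendsto_intros LIMSEQ_power_zero) auto
  then show "(\<lambda>n. c ^ n * D) \<longlonglongrightarrow> 0" by simp
qed (use assms in blast)

section \<open>Self-similar sets whose pieces meet along a tree\<close>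

text \<open>On distinct indices \<open>E\<close> is the intersection graph of the pieces, the images
  of \<open>F\<close> under the \<open>f i\<close>. The index type stays arbitrary so that the
  quadrilaterals of a labyrinth set can be the indices and \<open>tree\<close> can be stated for
  their own adjacency.\<close>

locale tree_ifs =
  fixes F :: "'a::heine_borel set" and I :: "'i set" and f :: "'i \<Rightarrow> 'a \<Rightarrow> 'a" and c :: real
    and E :: "'i \<Rightarrow> 'i \<Rightarrow> bool"
  assumes compact_F: "compact F"
    and F_eq: "F = (\<Union>i\<in>I. f i ` F)"
    and c: "0 < c" "c < 1"
    and dist_f: "\<And>i x y. i \<in> I \<Longrightarrow> dist (f i x) (f i y) = c * dist x y"
    and E_sym: "\<And>i j. E i j \<Longrightarrow> E j i"
    and E_meet: "\<And>i j. i \<in> I \<Longrightarrow> j \<in> I \<Longrightarrow> E i j \<Longrightarrow> f i ` F \<inter> f j ` F \<noteq> {}"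
    and meet_E: "\<And>i j. i \<in> I \<Longrightarrow> j \<in> I \<Longrightarrow> i \<noteq> j \<Longrightarrow> f i ` F \<inter> f j ` F \<noteq> {} \<Longrightarrow> E i j"
    and meet_unique: "\<And>i j x y. i \<in> I \<Longrightarrow> j \<in> I \<Longrightarrow> i \<noteq> j \<Longrightarrow>
      x \<in> f i ` F \<inter> f j ` F \<Longrightarrow> y \<in> f i ` F \<inter> f j ` F \<Longrightarrow> x = y"
    and tree: "graph_tree I E"
begin

lemma finite_I: "finite I"
  using tree by (simp add: graph_tree_def)

lemma continuous_f: "i \<in> I \<Longrightarrow> continuous_on X (f i)"
  using dist_f c by (intro lipschitz_on_continuous_on[where L = c] lipschitz_onI) auto

lemma compact_piece: "i \<in> I \<Longrightarrow> compact (f i ` F)"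
  using compact_F continuous_f compact_continuous_image by blast

lemma bounded_dist: obtains D where "\<And>x y. x \<in> F \<Longrightarrow> y \<in> F \<Longrightarrow> dist x y \<le> D"
  using compact_imp_bounded[OF compact_F] that unfolding bounded_two_points by blast

lemma image_in_F: "i \<in> I \<Longrightarrow> x \<in> F \<Longrightarrow> f i x \<in> F"
  by (subst F_eq) blast

lemma geometric_small:
  assumes "e > 0" obtains n where "c ^ n * D < e"
proof -
  have "\<exists>n. c ^ n * D < e" using le_0_if_le_geometric[OF c, of e D] assms by (meson not_le)
  then show ?thesis using that by blast
qed

text \<open>Inside one piece, \<open>f i\<close> maps a chain of level \<open>n\<close> to a chain
  of level \<open>Suc n\<close>, with steps shrunk by \<open>c\<close>. Different pieces are linked
  along a path of the graph, passing through common points of consecutive pieces.\<close>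

lemma chains:
  assumes D: "\<And>x y. x \<in> F \<Longrightarrow> y \<in> F \<Longrightarrow> dist x y \<le> D"
  shows "x \<in> F \<Longrightarrow> y \<in> F \<Longrightarrow> (x, y) \<in> {(a, b). a \<in> F \<and> b \<in> F \<and> dist a b \<le> c ^ n * D}\<^sup>*"
proof (induction n arbitrary: x y)
  case 0
  then show ?case using D by auto
next
  case (Suc n)
  let ?R = "\<lambda>n. {(a, b). a \<in> F \<and> b \<in> F \<and> dist a b \<le> c ^ n * D}\<^sup>*"
  have within: "(f i u, f i v) \<in> ?R (Suc n)" if i: "i \<in> I" and "u \<in> F" "v \<in> F" for i u v
  proof -
    have "(u, v) \<in> ?R n" using Suc.IH that by blast
    then show ?thesis
    proof (induction rule: rtrancl_induct)
      case (step v w)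
      have "(f i v, f i w) \<in> {(a, b). a \<in> F \<and> b \<in> F \<and> dist a b \<le> c ^ Suc n * D}"
        using step i c by (auto simp: image_in_F dist_f intro: mult_left_mono)
      then show ?case by (rule rtrancl.rtrancl_into_rtrancl[OF step.IH])
    qed simp
  qed
  obtain i j where ij: "i \<in> I" "j \<in> I" "x \<in> f i ` F" "y \<in> f j ` F"
    using Suc.prems F_eq by blast
  have "(i, j) \<in> {(a, b). a \<in> I \<and> b \<in> I \<and> E a b}\<^sup>*"
    using tree ij by (simp add: graph_tree_def graph_connected_def)
  \<comment> \<open>The induction along the graph path must reach every point of the current piece,
    since the point where the next piece is entered is not known beforehand.\<close>
  then have "\<forall>y\<in>f j ` F. (x, y) \<in> ?R (Suc n)"
  proof (induction rule: rtrancl_induct)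
    case base
    obtain u where u: "u \<in> F" "x = f i u" using ij(3) by blast
    show ?case
    proof
      fix y assume "y \<in> f i ` F"
      then obtain v where "v \<in> F" "y = f i v" by blast
      then show "(x, y) \<in> ?R (Suc n)" using within[of i u v] ij(1) u by simp
    qed
  next
    case (step j k)
    then obtain p where p: "p \<in> f j ` F" "p \<in> f k ` F" using E_meet by blast
    have "(x, p) \<in> ?R (Suc n)" using step p by blast
    moreover have "(p, y) \<in> ?R (Suc n)" if y: "y \<in> f k ` F" for y
    proof -
      obtain u v where "p = f k u" "y = f k v" "u \<in> F" "v \<in> F" using p(2) y by blast
      then show ?thesis using within[of k u v] step(2) by simp
    qed
    ultimately show ?case by (blast intro: rtrancl_trans)
  qed
  then show ?case using ij by blast
qed

lemma connected_F: "connected F"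
proof (rule chain_connected_imp_connected[OF compact_F])
  fix e :: real and x y assume e: "e > 0" and xy: "x \<in> F" "y \<in> F"
  obtain D where D: "\<And>x y. x \<in> F \<Longrightarrow> y \<in> F \<Longrightarrow> dist x y \<le> D" using bounded_dist by blast
  obtain n where n: "c ^ n * D < e" using geometric_small[OF e] by blast
  have "{(a, b). a \<in> F \<and> b \<in> F \<and> dist a b \<le> c ^ n * D} \<subseteq> {(a, b). a \<in> F \<and> b \<in> F \<and> dist a b < e}"
    using n by auto
  then show "(x, y) \<in> {(a, b). a \<in> F \<and> b \<in> F \<and> dist a b < e}\<^sup>*"
    using chains[OF D xy, of n] rtrancl_mono by blast
qed

text \<open>The pieces are the images of \<open>F\<close> under all \<open>n\<close>-fold
  compositions. They inherit connectedness from \<open>F\<close>, so \<open>connected_F\<close> has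
  to come first.\<close>

lemma small_pieces:
  assumes D: "\<And>x y. x \<in> F \<Longrightarrow> y \<in> F \<Longrightarrow> dist x y \<le> D"
  shows "\<exists>\<P>. finite \<P> \<and> \<Union>\<P> = F \<and>
    (\<forall>P\<in>\<P>. compact P \<and> connected P \<and> (\<forall>x\<in>P. \<forall>y\<in>P. dist x y \<le> c ^ n * D))"
proof (induction n)
  case 0
  show ?case by (intro exI[of _ "{F}"]) (use D compact_F connected_F in auto)
next
  case (Suc n)
  then obtain \<P> where \<P>: "finite \<P>" "\<Union>\<P> = F" "\<And>P. P \<in> \<P> \<Longrightarrow> compact P"
    "\<And>P. P \<in> \<P> \<Longrightarrow> connected P" "\<And>P x y. P \<in> \<P> \<Longrightarrow> x \<in> P \<Longrightarrow> y \<in> P \<Longrightarrow> dist x y \<le> c ^ n * D"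
    by blast
  let ?\<Q> = "(\<lambda>(i, P). f i ` P) ` (I \<times> \<P>)"
  have "\<Union>?\<Q> = (\<Union>i\<in>I. f i ` \<Union>\<P>)" by auto
  then have "\<Union>?\<Q> = F" using \<P>(2) by (simp add: F_eq[symmetric])
  moreover have "finite ?\<Q>" using finite_I \<P>(1) by blast
  moreover have "compact Q \<and> connected Q \<and> (\<forall>x\<in>Q. \<forall>y\<in>Q. dist x y \<le> c ^ Suc n * D)"
    if "Q \<in> ?\<Q>" for Q
  proof -
    obtain i P where iP: "i \<in> I" "P \<in> \<P>" "Q = f i ` P" using \<open>Q \<in> ?\<Q>\<close> by auto
    have "dist (f i x) (f i y) \<le> c ^ Suc n * D" if "x \<in> P" "y \<in> P" for x y
      using \<P>(5)[OF iP(2) that] c iP(1) by (simp add: dist_f mult.assoc)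
    then show ?thesis
      using iP \<P>(3,4) continuous_f[OF iP(1)]
      by (auto intro: compact_continuous_image connected_continuous_image)
  qed
  ultimately show ?case by (intro exI[of _ ?\<Q>]) blast
qed

lemma locally_connected_F: "locally connected F"
proof (rule locally_connected_small_pieces)
  fix e :: real assume e: "e > 0"
  obtain D where D: "\<And>x y. x \<in> F \<Longrightarrow> y \<in> F \<Longrightarrow> dist x y \<le> D" using bounded_dist by blast
  obtain n where n: "c ^ n * D < e" using geometric_small[OF e] by blast
  show "\<exists>\<P>. finite \<P> \<and> \<Union>\<P> = F \<and>
    (\<forall>P\<in>\<P>. closed P \<and> connected P \<and> (\<forall>x\<in>P. \<forall>y\<in>P. dist x y < e))"
    using small_pieces[OF D, of n] n by (meson compact_imp_closed le_less_trans)
qed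

text \<open>A leaf of the graph induced on \<open>J\<close> meets the union of the other pieces in at most one point,
  so leaves can be discarded until a single piece is left.\<close>
lemma no_cut_point_in_piece:
  assumes C: "no_cut_point C" "C \<noteq> {}" and "J \<subseteq> I" "C \<subseteq> (\<Union>i\<in>J. f i ` F)"
  shows "\<exists>i\<in>J. C \<subseteq> f i ` F"
proof -
  have "finite J" using finite_I \<open>J \<subseteq> I\<close> finite_subset by blast
  then show ?thesis using assms(3,4)
  proof (induction J rule: finite_psubset_induct)
    case (psubset J)
    have "J \<noteq> {}" using psubset.prems C by auto
    moreover have "\<nexists>cs. graph_cycle J E cs"
      using tree graph_cycle_mono psubset.prems(1) by (metis graph_tree_def)
    ultimately obtain v where v: "v \<in> J"
      "\<And>a b. a \<in> J - {v} \<Longrightarrow> b \<in> J - {v} \<Longrightarrow> E v a \<Longrightarrow> E v b \<Longrightarrow> a = b"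
      using acyclic_graph_has_leaf[of J E] E_sym psubset.hyps by blast
    let ?B = "\<Union>i\<in>J - {v}. f i ` F"
    have "C \<subseteq> f v ` F \<or> C \<subseteq> ?B"
    proof (rule no_cut_point_subset_cases[OF C(1)])
      show "C \<subseteq> f v ` F \<union> ?B" using psubset.prems by blast
      show "closed (f v ` F)" using v psubset.prems by (intro compact_imp_closed compact_piece) auto
      show "closed ?B" using psubset.prems psubset.hyps
        by (intro closed_UN ballI compact_imp_closed compact_piece) auto
      fix x y assume x: "x \<in> f v ` F \<inter> ?B" and y: "y \<in> f v ` F \<inter> ?B"
      obtain a where a: "a \<in> J - {v}" "x \<in> f a ` F" using x by blast
      obtain b where b: "b \<in> J - {v}" "y \<in> f b ` F" using y by blast
      have "E v a" using meet_E[of v a] a x v psubset.prems by blast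
      moreover have "E v b" using meet_E[of v b] b y v psubset.prems by blast
      ultimately have "a = b" using v a b by blast
      then show "x = y" using meet_unique[of v a x y] a b x y v psubset.prems by blast
    qed
    then show ?case
    proof
      assume "C \<subseteq> ?B"
      moreover have "J - {v} \<subset> J" using v by blast
      ultimately show ?thesis using psubset.IH[of "J - {v}"] psubset.prems by blast
    qed (use v in blast)
  qed
qed

text \<open>Such a set lies in a single piece. Pulled back by the similarity of that piece it is
  again a subset of \<open>F\<close> without cut points, with distances enlarged by
  \<open>1 / c\<close>, so the bound of level \<open>n\<close> for the pullback gives that of level
  \<open>Suc n\<close> for \<open>C\<close>.\<close>

lemma no_cut_point_dist_le:
  assumes D: "\<And>x y. x \<in> F \<Longrightarrow> y \<in> F \<Longrightarrow> dist x y \<le> D"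
  shows "no_cut_point C \<Longrightarrow> C \<subseteq> F \<Longrightarrow> x \<in> C \<Longrightarrow> y \<in> C \<Longrightarrow> dist x y \<le> c ^ n * D"
proof (induction n arbitrary: C x y)
  case 0
  then show ?case using D by auto
next
  case (Suc n)
  have "C \<subseteq> (\<Union>i\<in>I. f i ` F)" using Suc.prems by (simp add: F_eq[symmetric])
  then obtain i where i: "i \<in> I" "C \<subseteq> f i ` F"
    using no_cut_point_in_piece[of C I] Suc.prems by blast
  define g where "g = inv_into F (f i)"
  have g: "g z \<in> F" "f i (g z) = z" if "z \<in> C" for z
    using i that unfolding g_def by (auto simp: inv_into_into f_inv_into_f)
  have dist_g: "dist (g u) (g v) = dist u v / c" if "u \<in> C" "v \<in> C" for u v
    using dist_f[OF i(1), of "g u" "g v"] g that c by simp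
  have "no_cut_point (g ` C)"
  proof (rule no_cut_point_image[OF Suc.prems(1)])
    show "continuous_on C g"
      using c dist_g by (intro lipschitz_on_continuous_on[where L = "1 / c"] lipschitz_onI) auto
    show "inj_on g C" using g by (metis inj_onI)
  qed
  then have "dist (g x) (g y) \<le> c ^ n * D"
    using Suc.IH[of "g ` C" "g x" "g y"] Suc.prems g by blast
  then show ?case using dist_g Suc.prems c by (simp add: field_simps)
qed

lemma no_cut_point_trivial:
  assumes "no_cut_point C" "C \<subseteq> F" "x \<in> C" "y \<in> C"
  shows "x = y"
proof -
  obtain D where D: "\<And>x y. x \<in> F \<Longrightarrow> y \<in> F \<Longrightarrow> dist x y \<le> D" using bounded_dist by blast
  have "dist x y \<le> 0"
    by (rule le_0_if_le_geometric[OF c]) (rule no_cut_point_dist_le[OF D assms])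
  then show ?thesis by simp
qed

end

section \<open>Transfer to homeomorphic images\<close>

lemma no_cut_point_homeomorphic:
  assumes "no_cut_point S" "S homeomorphic T"
  shows "no_cut_point T"
proof -
  obtain g h where "homeomorphism S T g h" using assms(2) homeomorphic_def by blast
  then show ?thesis
    using no_cut_point_image[OF assms(1), of g]
    by (metis homeomorphism_cont1 homeomorphism_image1 homeomorphism_apply1 inj_onI)
qed

text \<open>The maps \<open>P_W\<close> on \<open>Q\<close> are in general no similarities, so
  \<open>tree_ifs\<close> is applied to a model and the result is transported. By compactness
  \<open>g\<close> is a homeomorphism onto its image; a circle in the image would pull back to a set
  without cut points in \<open>F\<close>, hence to a point.\<close>

lemma dendrite_injective_image:
  assumes "tree_ifs F I f c E" "F \<noteq> {}" and g: "continuous_on F g" "inj_on g F"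
  shows "dendrite (g ` F)"
proof -
  interpret tree_ifs F I f c E by fact
  have hom: "F homeomorphic g ` F"
    using homeomorphic_compact[OF compact_F g(1) refl g(2)] .
  then obtain h where h: "homeomorphism F (g ` F) g h"
    using homeomorphism_compact[OF compact_F g(1) refl g(2)] by blast
  have "locally connected (g ` F)"
    using homeomorphic_locally[OF hom, of connected connected] homeomorphic_connectedness
      locally_connected_F by blast
  moreover have "\<not> C homeomorphic sphere (0::pt) 1" if C: "C \<subseteq> g ` F" for C
  proof
    assume hC: "C homeomorphic sphere (0::pt) 1"
    then have "no_cut_point C"
      using no_cut_point_homeomorphic[OF no_cut_point_circle] homeomorphic_sym by blast
    moreover have gh: "g (h x) = x" if "x \<in> C" for x
      using homeomorphism_apply2[OF h] C that by blast
    then have "inj_on h C" by (metis inj_onI)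
    moreover have "continuous_on C h"
      using homeomorphism_cont2[OF h] C continuous_on_subset by blast
    ultimately have "no_cut_point (h ` C)" by (intro no_cut_point_image)
    moreover have "h ` C \<subseteq> F" using C homeomorphism_image2[OF h] by blast
    ultimately have "h x = h y" if "x \<in> C" "y \<in> C" for x y
      using no_cut_point_trivial[of "h ` C" "h x" "h y"] that by simp
    then have "x = y" if "x \<in> C" "y \<in> C" for x y
      using gh that by metis
    moreover obtain k l where kl: "homeomorphism C (sphere (0::pt) 1) k l"
      using hC homeomorphic_def by blast
    \<comment> \<open>Two antipodal points, as a witness that the circle has more than one
      point.\<close>
    moreover define u :: pt where "u = axis 1 1"
    have u: "u \<in> sphere 0 1" "- u \<in> sphere 0 1" by (simp_all add: u_def norm_axis_1)
    ultimately have "l u = l (- u)" using homeomorphism_image2[OF kl] by blast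
    then have "u = - u" using homeomorphism_apply2[OF kl] u by metis
    then have "u $ 1 = - (u $ 1)" by (metis vector_uminus_component)
    then show False by (simp add: u_def)
  qed
  ultimately show ?thesis
    unfolding dendrite_def
    using \<open>F \<noteq> {}\<close> compact_continuous_image[OF g(1) compact_F]
      connected_continuous_image[OF g(1) connected_F] by auto
qed

section \<open>Labyrinth fractals in the unit square\<close>

text \<open>The grid size \<open>N\<close> is a parameter because compositions of cell maps are cell
  maps of a finer grid.\<close>

definition cell_map :: "nat \<Rightarrow> nat \<times> nat \<Rightarrow> real \<times> real \<Rightarrow> real \<times> real" where
  "cell_map N k z = ((real (fst k) + fst z) / real N, (real (snd k) + snd z) / real N)"

definition unit_square :: "(real \<times> real) set" where
  "unit_square = {0..1} \<times> {0..1}"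

definition cell_adj :: "nat \<times> nat \<Rightarrow> nat \<times> nat \<Rightarrow> bool" where
  "cell_adj k k' \<longleftrightarrow>
     fst k = fst k' \<and> (snd k' = Suc (snd k) \<or> snd k = Suc (snd k')) \<or>
     snd k = snd k' \<and> (fst k' = Suc (fst k) \<or> fst k = Suc (fst k'))"

lemma dist_cell_map: "dist (cell_map N k x) (cell_map N k y) = (1 / real N) * dist x y"
proof -
  have "cell_map N k x - cell_map N k y = (1 / real N) *\<^sub>R (x - y)"
    by (simp add: cell_map_def prod_eq_iff diff_divide_distrib[symmetric])
  then show ?thesis by (simp add: dist_norm)
qed

text \<open>Cell indices compose like digits in base \<open>m\<close>.\<close>

lemma cell_map_compose:
  assumes "m > 0"
  shows "cell_map N (i, j) (cell_map m (i', j') z) = cell_map (N * m) (i * m + i', j * m + j') z"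
  using assms by (simp add: cell_map_def field_simps)

lemma continuous_cell_map: "continuous_on X (cell_map N k)"
  by (intro lipschitz_on_continuous_on[where L = "1 / real N"] lipschitz_onI) (auto simp: dist_cell_map)

lemma cell_map_eq_iff: "N > 0 \<Longrightarrow> cell_map N k z = cell_map N k w \<longleftrightarrow> z = w"
  by (auto simp: cell_map_def prod_eq_iff)

lemma cell_map_in_unit_square:
  assumes "fst k < N" "snd k < N" "z \<in> unit_square"
  shows "cell_map N k z \<in> unit_square"
  using assms by (auto simp: cell_map_def unit_square_def divide_le_eq)

text \<open>The integer difference of \<open>i'\<close> and \<open>i\<close> equals
  \<open>u - v\<close>, which lies between -1 and 1; the extreme values force \<open>u\<close> and
  \<open>v\<close> to opposite ends of the unit interval. Applied to both coordinates, this
  describes how two cells can meet.\<close>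

lemma nat_offset_cases:
  fixes u v :: real
  assumes "real i + u = real i' + v" "0 \<le> u" "u \<le> 1" "0 \<le> v" "v \<le> 1"
  shows "i' = i \<and> u = v \<or> i' = Suc i \<and> u = 1 \<and> v = 0 \<or> i = Suc i' \<and> u = 0 \<and> v = 1"
proof -
  consider "i' = i" | "i' = Suc i" | "i = Suc i'" | "i' \<ge> Suc (Suc i)" | "i \<ge> Suc (Suc i')"
    by linarith
  then show ?thesis
    using assms by cases auto
qed

section \<open>The fractal of a labyrinth pattern in the unit square\<close>

text \<open>The exit and corner properties in grid coordinates, a pair being (column, row). Row
  \<open>r\<close> joins the left and right exits, column \<open>s\<close> the bottom and top ones.
  The tree property is added in \<open>tree_ifs_fractal\<close>.\<close>

locale square_labyrinth =
  fixes m :: nat and K :: "(nat \<times> nat) set" and r s :: nat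
  assumes m: "2 \<le> m"
    and K: "K \<subseteq> {..<m} \<times> {..<m}"
    and row: "(0, r) \<in> K" "(m - 1, r) \<in> K"
    and row_unique: "\<And>j. (0, j) \<in> K \<Longrightarrow> (m - 1, j) \<in> K \<Longrightarrow> j = r"
    and col: "(s, 0) \<in> K" "(s, m - 1) \<in> K"
    and col_unique: "\<And>i. (i, 0) \<in> K \<Longrightarrow> (i, m - 1) \<in> K \<Longrightarrow> i = s"
    and corner: "\<not> ((0, 0) \<in> K \<and> (m - 1, m - 1) \<in> K)" "\<not> ((m - 1, 0) \<in> K \<and> (0, m - 1) \<in> K)"
begin

definition refine :: "(real \<times> real) set \<Rightarrow> (real \<times> real) set" where
  "refine X = (\<Union>k\<in>K. cell_map m k ` X)"

definition fractal :: "(real \<times> real) set" where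
  "fractal = (\<Inter>n. (refine ^^ n) unit_square)"

lemma K_less: "k \<in> K \<Longrightarrow> fst k < m" "k \<in> K \<Longrightarrow> snd k < m"
  using K by auto

lemma finite_K: "finite K"
  using K finite_subset by blast

lemma refine_mono: "X \<subseteq> Y \<Longrightarrow> refine X \<subseteq> refine Y"
  unfolding refine_def by blast

lemma refine_unit_square: "refine unit_square \<subseteq> unit_square"
  using cell_map_in_unit_square K_less unfolding refine_def by blast

lemma refine_decseq: "(refine ^^ Suc n) unit_square \<subseteq> (refine ^^ n) unit_square"
  by (induction n) (use refine_unit_square refine_mono in auto)

lemma refine_antimono: "n \<le> n' \<Longrightarrow> (refine ^^ n') unit_square \<subseteq> (refine ^^ n) unit_square"
  using lift_Suc_antimono_le[of "\<lambda>n. (refine ^^ n) unit_square"] refine_decseq by blast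

text \<open>Index shift needed later: \<open>lab_W\<close> starts with \<open>W1\<close> at index 0,
  so \<open>lab_L\<close> at index \<open>n\<close> corresponds to \<open>Suc n\<close> refinements
  of the square.\<close>

lemma fractal_eq_Suc: "fractal = (\<Inter>n. (refine ^^ Suc n) unit_square)"
  unfolding fractal_def using refine_decseq by blast

lemma fractal_subset: "fractal \<subseteq> unit_square"
  unfolding fractal_def using INT_lower[of 0 UNIV "\<lambda>n. (refine ^^ n) unit_square"] by simp

text \<open>For the inclusion from left to right, a point lies at every stage \<open>n\<close> in
  some cell \<open>k n\<close>, and by the pigeonhole principle one cell occurs infinitely often.
  Its map is injective, so the preimage \<open>w\<close> is the same at all these stages, and as the
  stages decrease, \<open>w\<close> belongs to all of them.\<close>

lemma fractal_cell: "fractal = (\<Union>k\<in>K. cell_map m k ` fractal)"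
proof
  have "cell_map m k w \<in> (refine ^^ Suc n) unit_square" if "k \<in> K" "w \<in> fractal" for k w n
    using that unfolding fractal_def by (auto simp: refine_def)
  then show "(\<Union>k\<in>K. cell_map m k ` fractal) \<subseteq> fractal"
    by (subst (2) fractal_eq_Suc) blast
  show "fractal \<subseteq> (\<Union>k\<in>K. cell_map m k ` fractal)"
  proof
    fix z assume z: "z \<in> fractal"
    have "\<exists>k\<in>K. z \<in> cell_map m k ` (refine ^^ n) unit_square" for n
      using z unfolding fractal_eq_Suc by (auto simp: refine_def)
    then obtain k where k: "\<And>n. k n \<in> K" "\<And>n. z \<in> cell_map m (k n) ` (refine ^^ n) unit_square"
      by metis
    have "finite (range k)" using k(1) by (intro finite_subset[OF _ finite_K]) auto
    then obtain n0 where "infinite {n. k n = k n0}"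
      using pigeonhole_infinite[of UNIV k] by auto
    then have inf: "\<exists>n'\<ge>n. k n' = k n0" for n
      by (metis (mono_tags) infinite_nat_iff_unbounded_le mem_Collect_eq)
    obtain w where w: "z = cell_map m (k n0) w" using k(2)[of n0] by blast
    have "w \<in> (refine ^^ n) unit_square" for n
    proof -
      obtain n' where n': "n' \<ge> n" "k n' = k n0" using inf by blast
      obtain w' where w': "w' \<in> (refine ^^ n') unit_square" "z = cell_map m (k n0) w'"
        using k(2)[of n'] n' by auto
      have "w' = w" using w w'(2) cell_map_eq_iff m by simp
      then show ?thesis using w' refine_antimono[OF n'(1)] by blast
    qed
    then have "w \<in> fractal" by (simp add: fractal_def)
    then show "z \<in> (\<Union>k\<in>K. cell_map m k ` fractal)" using w k(1) by blast
  qed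
qed

lemma fractal_cellE:
  assumes "z \<in> fractal"
  obtains k w where "k \<in> K" "w \<in> fractal" "z = cell_map m k w"
proof -
  have "z \<in> (\<Union>k\<in>K. cell_map m k ` fractal)" using assms fractal_cell by simp
  then show ?thesis using that by blast
qed

lemma compact_fractal: "compact fractal"
proof -
  have "compact ((refine ^^ n) unit_square)" for n
  proof (induction n)
    case 0
    show ?case by (simp add: unit_square_def compact_Times)
  next
    case (Suc n)
    then show ?case
      using finite_K by (auto simp: refine_def intro!: compact_UN compact_continuous_image continuous_cell_map)
  qed
  then have "closed fractal" unfolding fractal_def by (intro closed_INT ballI compact_imp_closed) auto
  moreover have "compact unit_square" by (simp add: unit_square_def compact_Times)
  ultimately show ?thesis using closed_Int_compact fractal_subset by (metis inf.absorb1)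
qed

lemma fixed_point_in_fractal:
  assumes "k \<in> K" "z \<in> unit_square" "cell_map m k z = z"
  shows "z \<in> fractal"
proof -
  have "z \<in> (refine ^^ n) unit_square" for n
  proof (induction n)
    case (Suc n)
    then have "cell_map m k z \<in> refine ((refine ^^ n) unit_square)"
      using assms(1) unfolding refine_def by blast
    then show ?case by (simp add: assms(3))
  qed (use assms in simp)
  then show ?thesis by (simp add: fractal_def)
qed

section \<open>Exits, sides and corners of the fractal\<close>

text \<open>The fixed point of the contraction sending \<open>t\<close> to
  \<open>(r + t) / m\<close>: the number all of whose base \<open>m\<close> digits are
  \<open>r\<close>.\<close>

definition exit_row :: real where "exit_row = real r / (real m - 1)"
definition exit_col :: real where "exit_col = real s / (real m - 1)"

lemma exit_row: "0 \<le> exit_row" "exit_row \<le> 1" "(real r + exit_row) / real m = exit_row"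
  using m K_less(2)[OF row(1)] by (auto simp: exit_row_def field_simps)

lemma exit_col: "0 \<le> exit_col" "exit_col \<le> 1" "(real s + exit_col) / real m = exit_col"
  using m K_less(1)[OF col(1)] by (auto simp: exit_col_def field_simps)

text \<open>Each exit is the fixed point of the map of its exit cell, hence survives every
  refinement.\<close>

lemma exits_in_fractal:
  "(0, exit_row) \<in> fractal" "(1, exit_row) \<in> fractal"
  "(exit_col, 0) \<in> fractal" "(exit_col, 1) \<in> fractal"
  using m exit_row exit_col
  by (auto intro: fixed_point_in_fractal[OF row(1)] fixed_point_in_fractal[OF row(2)]
      fixed_point_in_fractal[OF col(1)] fixed_point_in_fractal[OF col(2)]
      simp: unit_square_def cell_map_def of_nat_diff)

lemma fractal_coords:
  assumes "(x, y) \<in> fractal"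
  obtains i j u v where "(i, j) \<in> K" "(u, v) \<in> fractal" "0 \<le> u" "u \<le> 1" "0 \<le> v" "v \<le> 1"
    "real m * x = real i + u" "real m * y = real j + v" "i < m" "j < m"
proof -
  obtain k w where kw: "k \<in> K" "w \<in> fractal" "(x, y) = cell_map m k w"
    using assms fractal_cellE by blast
  show ?thesis
    using that[of "fst k" "snd k" "fst w" "snd w"] kw m fractal_subset K_less[OF kw(1)]
    by (auto simp: cell_map_def unit_square_def)
qed

text \<open>Sides are self-similar: the coordinate that is 0 or 1 forces both the cell index and the
  offset to their extreme value, so the preimage lies on the same side again. Likewise for the three
  sides below.\<close>

lemma fractal_left:
  assumes "(0, y) \<in> fractal"
  obtains j v where "(0, j) \<in> K" "(0, v) \<in> fractal" "0 \<le> v" "v \<le> 1" "real m * y = real j + v"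
  using assms
proof (rule fractal_coords)
  fix i j u v assume *: "(i, j) \<in> K" "(u, v) \<in> fractal" "0 \<le> u" "0 \<le> v" "v \<le> 1"
    "real m * 0 = real i + u" "real m * y = real j + v"
  then have "i = 0" "u = 0" by auto
  then show ?thesis using that * by blast
qed

lemma fractal_right:
  assumes "(1, y) \<in> fractal"
  obtains j v where "(m - 1, j) \<in> K" "(1, v) \<in> fractal" "0 \<le> v" "v \<le> 1" "real m * y = real j + v"
  using assms
proof (rule fractal_coords)
  fix i j u v assume *: "(i, j) \<in> K" "(u, v) \<in> fractal" "u \<le> 1" "0 \<le> v" "v \<le> 1"
    "real m * 1 = real i + u" "real m * y = real j + v" "i < m"
  then have "i = m - 1" "u = 1" by linarith+
  then show ?thesis using that * by blast
qed

lemma fractal_bottom: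
  assumes "(x, 0) \<in> fractal"
  obtains i u where "(i, 0) \<in> K" "(u, 0) \<in> fractal" "0 \<le> u" "u \<le> 1" "real m * x = real i + u"
  using assms
proof (rule fractal_coords)
  fix i j u v assume *: "(i, j) \<in> K" "(u, v) \<in> fractal" "0 \<le> v" "0 \<le> u" "u \<le> 1"
    "real m * 0 = real j + v" "real m * x = real i + u"
  then have "j = 0" "v = 0" by auto
  then show ?thesis using that * by blast
qed

lemma fractal_top:
  assumes "(x, 1) \<in> fractal"
  obtains i u where "(i, m - 1) \<in> K" "(u, 1) \<in> fractal" "0 \<le> u" "u \<le> 1" "real m * x = real i + u"
  using assms
proof (rule fractal_coords)
  fix i j u v assume *: "(i, j) \<in> K" "(u, v) \<in> fractal" "v \<le> 1" "0 \<le> u" "u \<le> 1"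
    "real m * 1 = real j + v" "real m * x = real i + u" "j < m"
  then have "j = m - 1" "v = 1" by linarith+
  then show ?thesis using that * by blast
qed

lemma fractal_corners:
  "(0, 0) \<in> fractal \<Longrightarrow> (0, 0) \<in> K" "(1, 1) \<in> fractal \<Longrightarrow> (m - 1, m - 1) \<in> K"
  "(1, 0) \<in> fractal \<Longrightarrow> (m - 1, 0) \<in> K" "(0, 1) \<in> fractal \<Longrightarrow> (0, m - 1) \<in> K"
proof -
  assume "(0, 0) \<in> fractal"
  then show "(0, 0) \<in> K" by (rule fractal_left) (auto simp: add_nonneg_eq_0_iff)
next
  assume "(1, 1) \<in> fractal"
  then show "(m - 1, m - 1) \<in> K"
  proof (rule fractal_right)
    fix j v assume *: "(m - 1, j) \<in> K" "v \<le> 1" "real m * 1 = real j + v"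
    then have "j = m - 1" using K_less(2)[OF *(1)] by simp
    then show ?thesis using * by simp
  qed
next
  assume "(1, 0) \<in> fractal"
  then show "(m - 1, 0) \<in> K" by (rule fractal_right) (auto simp: add_nonneg_eq_0_iff)
next
  assume "(0, 1) \<in> fractal"
  then show "(0, m - 1) \<in> K"
  proof (rule fractal_left)
    fix j v assume *: "(0, j) \<in> K" "v \<le> 1" "real m * 1 = real j + v"
    then have "j = m - 1" using K_less(2)[OF *(1)] by simp
    then show ?thesis using * by simp
  qed
qed

text \<open>A corner of the square is reached only through the corner cell, so opposite corners
  would put opposite corner cells into \<open>K\<close>.\<close>

lemma corner_excl:
  "(0, 0) \<in> fractal \<Longrightarrow> (1, 1) \<notin> fractal" "(1, 0) \<in> fractal \<Longrightarrow> (0, 1) \<notin> fractal"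
  using fractal_corners corner by blast+

text \<open>The map sending \<open>y\<close> to \<open>m * y - a\<close> keeps \<open>Y\<close>
  inside itself and multiplies the distance to its fixed point \<open>e\<close> by \<open>m\<close>,
  while distances in the unit interval are at most 1.\<close>

lemma contracting_to_unique:
  fixes Y :: "real set"
  assumes Y: "\<And>y. y \<in> Y \<Longrightarrow> 0 \<le> y \<and> y \<le> 1" and e: "0 \<le> e" "e \<le> 1" "(a + e) / real m = e"
    and step: "\<And>y. y \<in> Y \<Longrightarrow> \<exists>v\<in>Y. real m * y = a + v"
  shows "y \<in> Y \<Longrightarrow> y = e"
proof -
  have bound: "y \<in> Y \<Longrightarrow> \<bar>y - e\<bar> \<le> (1 / real m) ^ n * 1" for n y
  proof (induction n arbitrary: y)
    case 0
    then show ?case using Y[of y] e by auto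
  next
    case (Suc n)
    then obtain v where v: "v \<in> Y" "real m * y = a + v" using step by blast
    have "real m * e = a + e" using e m by (simp add: field_simps)
    then have "real m * (y - e) = v - e" using v by (simp add: algebra_simps)
    then have "real m * \<bar>y - e\<bar> = \<bar>v - e\<bar>" by (metis abs_mult abs_of_nat)
    then have "\<bar>y - e\<bar> = (1 / real m) * \<bar>v - e\<bar>" using m by (simp add: field_simps)
    also have "\<dots> \<le> (1 / real m) * ((1 / real m) ^ n * 1)"
      by (intro mult_left_mono Suc.IH v) simp
    finally show ?case by simp
  qed
  assume "y \<in> Y"
  then have "\<bar>y - e\<bar> \<le> 0" using m by (intro le_0_if_le_geometric[OF _ _ bound]) auto
  then show "y = e" by simp
qed

text \<open>A point shared by the right and the left side lies, at every scale, in the one row that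
  contains cells on both sides: by the corner property it cannot be a common corner of
  two different rows.\<close>
lemma left_right_unique:
  assumes "(0, y) \<in> fractal" "(1, y) \<in> fractal"
  shows "y = exit_row"
proof (rule contracting_to_unique[of "{y. (0, y) \<in> fractal \<and> (1, y) \<in> fractal}"])
  fix y assume y: "y \<in> {y. (0, y) \<in> fractal \<and> (1, y) \<in> fractal}"
  then obtain j v where jv: "(0, j) \<in> K" "(0, v) \<in> fractal" "0 \<le> v" "v \<le> 1" "real m * y = real j + v"
    using fractal_left by blast
  obtain j' v' where jv': "(m - 1, j') \<in> K" "(1, v') \<in> fractal" "0 \<le> v'" "v' \<le> 1"
    "real m * y = real j' + v'"
    using y fractal_right by blast
  have "j' = j \<and> v = v'"
    using nat_offset_cases[of j v j' v'] jv jv' corner_excl by auto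
  then show "\<exists>v\<in>{y. (0, y) \<in> fractal \<and> (1, y) \<in> fractal}. real m * y = real r + v"
    using jv jv' row_unique by auto
qed (use assms exit_row fractal_subset in \<open>auto simp: unit_square_def\<close>)

lemma bottom_top_unique:
  assumes "(x, 0) \<in> fractal" "(x, 1) \<in> fractal"
  shows "x = exit_col"
proof (rule contracting_to_unique[of "{x. (x, 0) \<in> fractal \<and> (x, 1) \<in> fractal}"])
  fix x assume x: "x \<in> {x. (x, 0) \<in> fractal \<and> (x, 1) \<in> fractal}"
  then obtain i u where iu: "(i, 0) \<in> K" "(u, 0) \<in> fractal" "0 \<le> u" "u \<le> 1" "real m * x = real i + u"
    using fractal_bottom by blast
  obtain i' u' where iu': "(i', m - 1) \<in> K" "(u', 1) \<in> fractal" "0 \<le> u'" "u' \<le> 1"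
    "real m * x = real i' + u'"
    using x fractal_top by blast
  have "i' = i \<and> u = u'"
    using nat_offset_cases[of i u i' u'] iu iu' corner_excl by auto
  then show "\<exists>v\<in>{x. (x, 0) \<in> fractal \<and> (x, 1) \<in> fractal}. real m * x = real s + v"
    using iu iu' col_unique by auto
qed (use assms exit_col fractal_subset in \<open>auto simp: unit_square_def\<close>)

section \<open>How the pieces of the fractal meet\<close>

text \<open>By \<open>nat_offset_cases\<close> the cells are equal or touch. Diagonal contact would
  need opposite corners in the fractal, excluded by \<open>corner_excl\<close>; contact along a side
  needs points of opposite sides at the same height, which are the exits.\<close>

lemma cell_meet_cases:
  assumes z: "z \<in> fractal" and w: "w \<in> fractal" and eq: "cell_map m (i, j) z = cell_map m (i', j') w"
  shows "i' = i \<and> j' = j \<or>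
    i' = Suc i \<and> j' = j \<and> z = (1, exit_row) \<or> i = Suc i' \<and> j' = j \<and> z = (0, exit_row) \<or>
    i' = i \<and> j' = Suc j \<and> z = (exit_col, 1) \<or> i' = i \<and> j = Suc j' \<and> z = (exit_col, 0)"
proof -
  obtain a b c d where ab: "z = (a, b)" "w = (c, d)" by (metis surj_pair)
  have 1: "real i + a = real i' + c" "real j + b = real j' + d"
    using eq m by (auto simp: cell_map_def ab)
  have 2: "0 \<le> a" "a \<le> 1" "0 \<le> b" "b \<le> 1" "0 \<le> c" "c \<le> 1" "0 \<le> d" "d \<le> 1"
    using z w fractal_subset by (auto simp: ab unit_square_def)
  have corners: "\<not> (z = (0, 0) \<and> w = (1, 1))" "\<not> (z = (1, 1) \<and> w = (0, 0))"
    "\<not> (z = (1, 0) \<and> w = (0, 1))" "\<not> (z = (0, 1) \<and> w = (1, 0))"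
    using z w corner_excl by metis+
  have sides: "z = (0, b) \<Longrightarrow> w = (1, b) \<Longrightarrow> b = exit_row" "z = (1, b) \<Longrightarrow> w = (0, b) \<Longrightarrow> b = exit_row"
    "z = (a, 0) \<Longrightarrow> w = (a, 1) \<Longrightarrow> a = exit_col" "z = (a, 1) \<Longrightarrow> w = (a, 0) \<Longrightarrow> a = exit_col"
    using z w left_right_unique bottom_top_unique by metis+
  show ?thesis
    using nat_offset_cases[OF 1(1) 2(1,2,5,6)] nat_offset_cases[OF 1(2) 2(3,4,7,8)]
  proof (elim disjE conjE)
  qed (use corners sides in \<open>simp_all add: ab\<close>)
qed

lemma cells_meet_imp_adj:
  assumes "k \<noteq> k'" "cell_map m k ` fractal \<inter> cell_map m k' ` fractal \<noteq> {}"
  shows "cell_adj k k'"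
proof -
  obtain z w where zw: "z \<in> fractal" "w \<in> fractal" "cell_map m k z = cell_map m k' w"
    using assms(2) by blast
  show ?thesis
    using cell_meet_cases[of z w "fst k" "snd k" "fst k'" "snd k'"] zw assms(1)
    by (auto simp: cell_adj_def prod_eq_iff)
qed

lemma cells_meet_unique:
  assumes "k \<noteq> k'" "x \<in> cell_map m k ` fractal \<inter> cell_map m k' ` fractal"
    "y \<in> cell_map m k ` fractal \<inter> cell_map m k' ` fractal"
  shows "x = y"
proof -
  obtain z w where zw: "z \<in> fractal" "w \<in> fractal" "x = cell_map m k z" "x = cell_map m k' w"
    using assms(2) by blast
  obtain z' w' where zw': "z' \<in> fractal" "w' \<in> fractal" "y = cell_map m k z'" "y = cell_map m k' w'"
    using assms(3) by blast
  have "z = z'"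
    using cell_meet_cases[of z w "fst k" "snd k" "fst k'" "snd k'"]
      cell_meet_cases[of z' w' "fst k" "snd k" "fst k'" "snd k'"] zw zw' assms(1)
    by (auto simp: prod_eq_iff)
  then show ?thesis using zw zw' by simp
qed

text \<open>Opposite exits have the same height, so the exit of one cell coincides with the opposite
  exit of its neighbour.\<close>

lemma adj_cells_meet:
  assumes "cell_adj k k'"
  shows "cell_map m k ` fractal \<inter> cell_map m k' ` fractal \<noteq> {}"
proof -
  have right: "cell_map m (i, j) (1, exit_row) = cell_map m (Suc i, j) (0, exit_row)" for i j
    by (simp add: cell_map_def)
  have up: "cell_map m (i, j) (exit_col, 1) = cell_map m (i, Suc j) (exit_col, 0)" for i j
    by (simp add: cell_map_def)
  have 1: "cell_map m (i, j) ` fractal \<inter> cell_map m (Suc i, j) ` fractal \<noteq> {}" for i j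
    using right[of i j] exits_in_fractal by (metis IntI empty_iff imageI)
  have 2: "cell_map m (i, j) ` fractal \<inter> cell_map m (i, Suc j) ` fractal \<noteq> {}" for i j
    using up[of i j] exits_in_fractal by (metis IntI empty_iff imageI)
  obtain i j i' j' where k: "k = (i, j)" "k' = (i', j')" by (metis surj_pair)
  show ?thesis
    using assms 1[of i j] 1[of i' j] 2[of i j] 2[of i j'] unfolding k cell_adj_def
    by (auto simp: Int_commute)
qed

end

section \<open>Quadrilaterals as piecewise affine images of the square\<close>

text \<open>The line \<open>x = y\<close> goes to the diagonal through \<open>a\<close> and
  \<open>c\<close>, and the corners of the square go to \<open>a\<close>, \<open>b\<close>,
  \<open>c\<close>, \<open>d\<close> in order. Using \<open>max\<close> and \<open>min\<close> gives
  one formula on the whole plane, continuous by its form, so that injectivity holds globally as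
  \<open>inj\<close>.\<close>

fun quad_map :: "quad \<Rightarrow> real \<times> real \<Rightarrow> pt" where
  "quad_map (a, b, c, d) (x, y) =
     a + max (x - y) 0 *\<^sub>R (b - a) + min x y *\<^sub>R (c - a) + max (y - x) 0 *\<^sub>R (d - a)"

declare quad_map.simps [simp del]

definition corner_quad :: "(real \<times> real \<Rightarrow> pt) \<Rightarrow> quad" where
  "corner_quad g = (g (0, 0), g (1, 0), g (1, 1), g (0, 1))"

definition cell_quad :: "quad \<Rightarrow> nat \<Rightarrow> nat \<times> nat \<Rightarrow> quad" where
  "cell_quad Q N k = corner_quad (\<lambda>z. quad_map Q (cell_map N k z))"

text \<open>Cells share their vertices, so comparing sides of cells becomes comparing pairs of
  lattice indices.\<close>

definition lattice_point :: "quad \<Rightarrow> nat \<Rightarrow> nat \<times> nat \<Rightarrow> pt" where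
  "lattice_point Q N k = quad_map Q (real (fst k) / real N, real (snd k) / real N)"

lemma cell_quad_lattice:
  "cell_quad Q N (i, j) = (lattice_point Q N (i, j), lattice_point Q N (Suc i, j),
     lattice_point Q N (Suc i, Suc j), lattice_point Q N (i, Suc j))"
  by (simp add: cell_quad_def corner_quad_def cell_map_def lattice_point_def add.commute)

lemma quad_map_below:
  "y \<le> x \<Longrightarrow> quad_map (a, b, c, d) (x, y) = a + x *\<^sub>R (b - a) + y *\<^sub>R (c - b)"
  by (simp add: quad_map.simps algebra_simps min_def max_def)

lemma quad_map_above:
  "x \<le> y \<Longrightarrow> quad_map (a, b, c, d) (x, y) = a + x *\<^sub>R (c - d) + y *\<^sub>R (d - a)"
  by (simp add: quad_map.simps algebra_simps min_def max_def)

lemma lattice_point_below: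
  "j \<le> i \<Longrightarrow> lattice_point (a, b, c, d) N (i, j) =
     a + (real i / real N) *\<^sub>R (b - a) + (real j / real N) *\<^sub>R (c - b)"
  by (simp add: lattice_point_def quad_map_below divide_right_mono)

lemma lattice_point_above:
  "i \<le> j \<Longrightarrow> lattice_point (a, b, c, d) N (i, j) =
     a + (real i / real N) *\<^sub>R (c - d) + (real j / real N) *\<^sub>R (d - a)"
  by (simp add: lattice_point_def quad_map_above divide_right_mono)

lemma quad_map_barycentric_below:
  "y \<le> x \<Longrightarrow> quad_map (a, b, c, d) (x, y) = (1 - x) *\<^sub>R a + (x - y) *\<^sub>R b + y *\<^sub>R c"
  by (simp add: quad_map_below algebra_simps)

lemma quad_map_barycentric_above:
  "x \<le> y \<Longrightarrow> quad_map (a, b, c, d) (x, y) = (1 - y) *\<^sub>R a + x *\<^sub>R c + (y - x) *\<^sub>R d"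
  by (simp add: quad_map_above algebra_simps)

lemma continuous_quad_map: "continuous_on X (quad_map V)"
proof -
  obtain a b c d where V: "V = (a, b, c, d)" by (cases V)
  have "quad_map V = (\<lambda>z. a + max (fst z - snd z) 0 *\<^sub>R (b - a) + min (fst z) (snd z) *\<^sub>R (c - a)
      + max (snd z - fst z) 0 *\<^sub>R (d - a))"
    unfolding V by (rule ext) (metis prod.collapse quad_map.simps)
  then show ?thesis by (auto intro!: continuous_intros)
qed

lemma cross2_scaleR: "cross2 (k *\<^sub>R u) (l *\<^sub>R v) = k * l * cross2 u v"
  by (simp add: cross2_def algebra_simps)

text \<open>The cross product with the diagonal kills the \<open>min\<close> term; what remains is
  the signed distance from the diagonal up to a constant factor.\<close>

lemma cross2_quad_map:
  "cross2 (c - a) (quad_map (a, b, c, d) (x, y) - a) =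
     max (y - x) 0 * cross2 (d - c) (a - d) - max (x - y) 0 * cross2 (b - a) (c - b)"
  by (simp add: quad_map.simps cross2_def algebra_simps)

text \<open>Since \<open>p\<close> and \<open>q\<close> are positive, the signed distance from the
  diagonal is strictly monotone in \<open>x - y\<close> and determines it. The component along
  \<open>c - a\<close> then determines \<open>min x y\<close>.\<close>

lemma inj_quad_map:
  assumes "convex_quad_ccw Q"
  shows "inj (quad_map Q)"
proof (rule injI)
  fix z w assume eq: "quad_map Q z = quad_map Q w"
  obtain a b c d where Q: "Q = (a, b, c, d)" by (cases Q)
  obtain x y x' y' where z: "z = (x, y)" "w = (x', y')" by (metis surj_pair)
  define p q where "p = cross2 (b - a) (c - b)" and "q = cross2 (d - c) (a - d)"
  have pq: "p > 0" "q > 0" using assms by (simp_all add: Q convex_quad_ccw_def p_def q_def)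
  have "max (y - x) 0 * q - max (x - y) 0 * p = max (y' - x') 0 * q - max (x' - y') 0 * p"
    using cross2_quad_map[of c a b d x y] cross2_quad_map[of c a b d x' y'] eq
    by (simp add: Q z p_def q_def)
  moreover have "t = t'" if t: "max (-t) 0 * q - max t 0 * p = max (-t') 0 * q - max t' 0 * p" for t t'
  proof -
    have "0 < max (-t) 0 * q - max t 0 * p \<longleftrightarrow> t < 0" for t
    proof (cases "t < 0")
      case True
      then show ?thesis using mult_neg_pos[OF True pq(2)] by simp
    next
      case False
      then have "0 \<le> t * p" using pq by simp
      then show ?thesis using False by simp
    qed
    then have "t < 0 \<longleftrightarrow> t' < 0" using t by metis
    then show ?thesis using t pq by (cases "t < 0") auto
  qed
  ultimately have diff: "x - y = x' - y'" by (metis minus_diff_eq)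
  then have diff': "y - x = y' - x'" by simp
  have "min x y *\<^sub>R (c - a) = min x' y' *\<^sub>R (c - a)"
    using eq[unfolded Q z quad_map.simps diff diff'] by simp
  moreover have "c \<noteq> a"
    using pq(1) by (auto simp: p_def cross2_def algebra_simps)
  ultimately have "min x y = min x' y'" by simp
  then show "z = w" using diff by (auto simp: z min_def split: if_splits)
qed

text \<open>The coefficients in \<open>quad_map_barycentric_below\<close> and
  \<open>quad_map_barycentric_above\<close> are the coordinates \<open>qcoords\<close>, and
  \<open>Pmap\<close> reuses them with the vertices of \<open>V\<close>. Both the uniqueness
  required by \<open>THE\<close> and the fact that a point strictly above the line
  \<open>x = y\<close> misses the first triangle come from injectivity.\<close>

lemma Pmap_quad_map:
  assumes Q: "convex_quad_ccw Q" and z: "z \<in> unit_square"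
  shows "Pmap Q V (quad_map Q z) = quad_map V z"
proof -
  obtain a b c d where q: "Q = (a, b, c, d)" by (cases Q)
  obtain v1 v2 v3 v4 where v: "V = (v1, v2, v3, v4)" by (cases V)
  obtain x y where xy: "z = (x, y)" by (cases z)
  have bounds: "0 \<le> x" "x \<le> 1" "0 \<le> y" "y \<le> 1" using z by (auto simp: xy unit_square_def)
  have in1: "u *\<^sub>R a + v *\<^sub>R b + w *\<^sub>R c = quad_map Q (v + w, w)" if "u + v + w = 1" "v \<ge> 0" for u v w
  proof -
    have "u = 1 - (v + w)" using that by simp
    then show ?thesis using that(2) by (simp add: q quad_map_barycentric_below)
  qed
  have in2: "u *\<^sub>R a + v *\<^sub>R c + w *\<^sub>R d = quad_map Q (v, v + w)" if "u + v + w = 1" "w \<ge> 0" for u v w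
  proof -
    have "u = 1 - (v + w)" using that by simp
    then show ?thesis using that(2) by (simp add: q quad_map_barycentric_above)
  qed
  note inj = injD[OF inj_quad_map[OF Q]]
  show ?thesis
  proof (cases "y \<le> x")
    case True
    have eq: "quad_map Q z = (1 - x) *\<^sub>R a + (x - y) *\<^sub>R b + y *\<^sub>R c"
      using True by (simp add: q xy quad_map_barycentric_below)
    have "quad_map Q z \<in> convex hull {a, b, c}"
      unfolding convex_hull_3 eq using True bounds
      by (intro CollectI exI[of _ "1 - x"] exI[of _ "x - y"] exI[of _ y]) simp
    moreover have "(THE al. case al of (a1, a2, a3, a4) \<Rightarrow> a4 = 0 \<and> a1 \<ge> 0 \<and> a2 \<ge> 0 \<and> a3 \<ge> 0 \<and>
        a1 + a2 + a3 = 1 \<and> quad_map Q z = a1 *\<^sub>R a + a2 *\<^sub>R b + a3 *\<^sub>R c) = (1 - x, x - y, y, 0)"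
    proof (rule the_equality, goal_cases)
      case 1
      show ?case using True bounds eq by simp
    next
      case (2 al)
      obtain a1 a2 a3 a4 where al: "al = (a1, a2, a3, a4)" by (cases al)
      have "(x, y) = (a2 + a3, a3)"
        by (rule inj) (use 2 in \<open>auto simp: al in1 xy\<close>)
      then show ?case using 2 by (auto simp: al)
    qed
    ultimately have "qcoords Q (quad_map Q z) = (1 - x, x - y, y, 0)"
      by (simp add: qcoords_def q)
    then show ?thesis using True by (simp add: Pmap_def v xy quad_map_barycentric_below)
  next
    case False
    have eq: "quad_map Q z = (1 - y) *\<^sub>R a + x *\<^sub>R c + (y - x) *\<^sub>R d"
      using False by (simp add: q xy quad_map_barycentric_above)
    have "quad_map Q z \<notin> convex hull {a, b, c}"
    proof
      assume "quad_map Q z \<in> convex hull {a, b, c}"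
      then obtain u v w where "0 \<le> v" "u + v + w = 1" "quad_map Q z = u *\<^sub>R a + v *\<^sub>R b + w *\<^sub>R c"
        unfolding convex_hull_3 by blast
      then have "z = (v + w, w)" using in1 by (intro inj) simp
      then show False using False \<open>0 \<le> v\<close> by (simp add: xy)
    qed
    moreover have "(THE al. case al of (a1, a2, a3, a4) \<Rightarrow> a2 = 0 \<and> a1 \<ge> 0 \<and> a3 \<ge> 0 \<and> a4 \<ge> 0 \<and>
        a1 + a3 + a4 = 1 \<and> quad_map Q z = a1 *\<^sub>R a + a3 *\<^sub>R c + a4 *\<^sub>R d) = (1 - y, 0, x, y - x)"
    proof (rule the_equality, goal_cases)
      case 1
      show ?case using False bounds eq by simp
    next
      case (2 al)
      obtain a1 a2 a3 a4 where al: "al = (a1, a2, a3, a4)" by (cases al)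
      have "(x, y) = (a3, a3 + a4)"
        by (rule inj) (use 2 in \<open>auto simp: al in2 xy\<close>)
      then show ?case using 2 by (auto simp: al)
    qed
    ultimately have "qcoords Q (quad_map Q z) = (1 - y, 0, x, y - x)"
      by (simp add: qcoords_def q)
    then show ?thesis using False by (simp add: Pmap_def v xy quad_map_barycentric_above)
  qed
qed

text \<open>Each of the two triangles of a cell is a scaled copy of the lower or upper triangle of
  \<open>Q\<close>, possibly with its sides traversed in another order. The first two claims treat
  the triangle at \<open>v2\<close>, the last two that at \<open>v4\<close>.\<close>

lemma cell_quad_differences:
  assumes "cell_quad (a, b, c, d) N (i, j) = (v1, v2, v3, v4)"
  shows "j \<le> i \<Longrightarrow> v2 - v1 = (1 / real N) *\<^sub>R (b - a) \<and> v3 - v2 = (1 / real N) *\<^sub>R (c - b)"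
    and "i < j \<Longrightarrow> v2 - v1 = (1 / real N) *\<^sub>R (c - d) \<and> v3 - v2 = (1 / real N) *\<^sub>R (d - a)"
    and "i \<le> j \<Longrightarrow> v3 - v4 = (1 / real N) *\<^sub>R (c - d) \<and> v4 - v1 = (1 / real N) *\<^sub>R (d - a)"
    and "j < i \<Longrightarrow> v3 - v4 = (1 / real N) *\<^sub>R (b - a) \<and> v4 - v1 = (1 / real N) *\<^sub>R (c - b)"
  using assms
  by (auto simp: cell_quad_lattice lattice_point_below lattice_point_above
      add_divide_distrib scaleR_add_left)

text \<open>The kink of \<open>quad_map Q\<close> runs through cells with \<open>i = j\<close> only,
  and there along the diagonal of the cell. So both sides are affine on each half of the unit square
  and have the same linear part.\<close>

lemma quad_map_cell_quad:
  assumes N: "N > 0" and z: "z \<in> unit_square"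
  shows "quad_map (cell_quad Q N k) z = quad_map Q (cell_map N k z)"
proof -
  obtain a b c d where Q: "Q = (a, b, c, d)" by (cases Q)
  obtain i j where k: "k = (i, j)" by (cases k)
  obtain x y where xy: "z = (x, y)" by (cases z)
  obtain v1 v2 v3 v4 where V: "cell_quad (a, b, c, d) N (i, j) = (v1, v2, v3, v4)"
    by (metis surj_pair)
  note d = cell_quad_differences[OF V]
  have v1: "v1 = lattice_point (a, b, c, d) N (i, j)"
    using V by (simp add: cell_quad_lattice)
  have bounds: "0 \<le> x" "x \<le> 1" "0 \<le> y" "y \<le> 1" using z by (auto simp: xy unit_square_def)
  \<comment> \<open>For \<open>j < i\<close> the whole cell lies below the main diagonal, whichever
    of \<open>x\<close> and \<open>y\<close> is larger.\<close>
  have below: "(real j + y) / N \<le> (real i + x) / N" if "j < i \<or> j = i \<and> y \<le> x"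
    using that bounds by (intro divide_right_mono) auto
  have above: "(real i + x) / N \<le> (real j + y) / N" if "i < j \<or> i = j \<and> x \<le> y"
    using that bounds by (intro divide_right_mono) auto
  consider "y \<le> x" "j \<le> i" | "y \<le> x" "i < j" | "x \<le> y" "i \<le> j" | "x \<le> y" "j < i" by linarith
  then show ?thesis
  proof cases
    case 1
    have *: "(real j + y) / real N \<le> (real i + x) / real N" using 1 by (intro below) auto
    have "quad_map Q (cell_map N k z) = a + ((real i + x) / N) *\<^sub>R (b - a) + ((real j + y) / N) *\<^sub>R (c - b)"
      using * by (simp add: Q k xy cell_map_def quad_map_below)
    moreover have "quad_map (cell_quad Q N k) z = v1 + (x / N) *\<^sub>R (b - a) + (y / N) *\<^sub>R (c - b)"
      using 1 d(1) by (simp add: Q k xy V quad_map_below)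
    ultimately show ?thesis
      using 1 by (simp add: v1 lattice_point_below add_divide_distrib scaleR_add_left)
  next
    case 2
    have *: "(real i + x) / real N \<le> (real j + y) / real N" using 2 by (intro above) auto
    have "quad_map Q (cell_map N k z) = a + ((real i + x) / N) *\<^sub>R (c - d) + ((real j + y) / N) *\<^sub>R (d - a)"
      using * by (simp add: Q k xy cell_map_def quad_map_above)
    moreover have "quad_map (cell_quad Q N k) z = v1 + (x / N) *\<^sub>R (c - d) + (y / N) *\<^sub>R (d - a)"
      using 2 d(2) by (simp add: Q k xy V quad_map_below)
    ultimately show ?thesis
      using 2 by (simp add: v1 lattice_point_above add_divide_distrib scaleR_add_left)
  next
    case 3
    have *: "(real i + x) / real N \<le> (real j + y) / real N" using 3 by (intro above) auto
    have "quad_map Q (cell_map N k z) = a + ((real i + x) / N) *\<^sub>R (c - d) + ((real j + y) / N) *\<^sub>R (d - a)"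
      using * by (simp add: Q k xy cell_map_def quad_map_above)
    moreover have "quad_map (cell_quad Q N k) z = v1 + (x / N) *\<^sub>R (c - d) + (y / N) *\<^sub>R (d - a)"
      using 3 d(3) by (simp add: Q k xy V quad_map_above)
    ultimately show ?thesis
      using 3 by (simp add: v1 lattice_point_above add_divide_distrib scaleR_add_left)
  next
    case 4
    have *: "(real j + y) / real N \<le> (real i + x) / real N" using 4 by (intro below) auto
    have "quad_map Q (cell_map N k z) = a + ((real i + x) / N) *\<^sub>R (b - a) + ((real j + y) / N) *\<^sub>R (c - b)"
      using * by (simp add: Q k xy cell_map_def quad_map_below)
    moreover have "quad_map (cell_quad Q N k) z = v1 + (x / N) *\<^sub>R (b - a) + (y / N) *\<^sub>R (c - b)"
      using 4 d(4) by (simp add: Q k xy V quad_map_above)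
    ultimately show ?thesis
      using 4 by (simp add: v1 lattice_point_below add_divide_distrib scaleR_add_left)
  qed
qed

text \<open>Off the diagonal a cell is a parallelogram spanned by two adjacent sides of
  \<open>Q\<close>; on the diagonal it is a scaled copy of \<open>Q\<close>.\<close>

lemma convex_cell_quad:
  assumes N: "N > 0" and Q: "convex_quad_ccw Q"
  shows "convex_quad_ccw (cell_quad Q N k)"
proof -
  obtain a b c d where q: "Q = (a, b, c, d)" by (cases Q)
  obtain i j where k: "k = (i, j)" by (cases k)
  obtain v1 v2 v3 v4 where V: "cell_quad (a, b, c, d) N (i, j) = (v1, v2, v3, v4)"
    by (metis surj_pair)
  note d = cell_quad_differences[OF V]
  have neg: "v - w = (1 / real N) *\<^sub>R (p - q) \<Longrightarrow> w - v = (1 / real N) *\<^sub>R (q - p)" for v w p q :: pt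
    by (metis minus_diff_eq scaleR_minus_right)
  have scale: "cross2 ((1 / real N) *\<^sub>R u) ((1 / real N) *\<^sub>R v) > 0" if "cross2 u v > 0" for u v
    using that N by (simp add: cross2_scaleR)
  have pos: "cross2 (b - a) (c - b) > 0" "cross2 (c - b) (d - c) > 0"
    "cross2 (d - c) (a - d) > 0" "cross2 (a - d) (b - a) > 0"
    using Q by (simp_all add: q convex_quad_ccw_def)
  have pos': "cross2 (c - b) (a - b) > 0" "cross2 (a - b) (b - c) > 0" "cross2 (b - c) (b - a) > 0"
    "cross2 (c - d) (d - a) > 0" "cross2 (d - a) (d - c) > 0" "cross2 (a - d) (c - d) > 0"
    using pos(1,3) by (simp_all add: cross2_def algebra_simps)
  consider "i < j" | "i = j" | "j < i" by linarith
  then show ?thesis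
  proof cases
    case 1
    then have "v2 - v1 = (1 / real N) *\<^sub>R (c - d)" "v3 - v2 = (1 / real N) *\<^sub>R (d - a)"
      "v4 - v3 = (1 / real N) *\<^sub>R (d - c)" "v1 - v4 = (1 / real N) *\<^sub>R (a - d)"
      using d(2,3) by (auto intro: neg)
    then show ?thesis using pos pos' scale by (simp add: q k V convex_quad_ccw_def)
  next
    case 2
    then have "v2 - v1 = (1 / real N) *\<^sub>R (b - a)" "v3 - v2 = (1 / real N) *\<^sub>R (c - b)"
      "v4 - v3 = (1 / real N) *\<^sub>R (d - c)" "v1 - v4 = (1 / real N) *\<^sub>R (a - d)"
      using d(1,3) by (auto intro: neg)
    then show ?thesis using pos pos' scale by (simp add: q k V convex_quad_ccw_def)
  next
    case 3
    then have "v2 - v1 = (1 / real N) *\<^sub>R (b - a)" "v3 - v2 = (1 / real N) *\<^sub>R (c - b)"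
      "v4 - v3 = (1 / real N) *\<^sub>R (a - b)" "v1 - v4 = (1 / real N) *\<^sub>R (b - c)"
      using d(1,4) by (auto intro: neg)
    then show ?thesis using pos pos' scale by (simp add: q k V convex_quad_ccw_def)
  qed
qed

text \<open>The main point is that the convex hull of the four vertices is covered by the two
  triangles. The diagonals of a convex quadrilateral cross, which gives an affine relation with
  positive coefficients; adding a multiple of it trades weight on \<open>b\<close> and
  \<open>d\<close> for weight on \<open>a\<close> and \<open>c\<close>.\<close>

lemma quad_region_eq:
  assumes V: "convex_quad_ccw V"
  shows "quad_region V = quad_map V ` unit_square"
proof -
  obtain a b c d where Vq: "V = (a, b, c, d)" by (cases V)
  \<comment> \<open>Twice the areas of the triangles opposite to \<open>a\<close>, \<open>b\<close>,
    \<open>c\<close>, \<open>d\<close>; both sums in \<open>sum\<close> are twice the area of the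
    quadrilateral.\<close>
  define ta tb tc td where "ta = cross2 (c - b) (d - c)" and "tb = cross2 (d - c) (a - d)"
    and "tc = cross2 (a - d) (b - a)" and "td = cross2 (b - a) (c - b)"
  have pos: "ta > 0" "tb > 0" "tc > 0" "td > 0"
    using V by (simp_all add: Vq convex_quad_ccw_def ta_def tb_def tc_def td_def)
  have sum: "ta + tc = tb + td"
    by (simp add: ta_def tb_def tc_def td_def cross2_def algebra_simps)
  have rel: "ta *\<^sub>R a + tc *\<^sub>R c = tb *\<^sub>R b + td *\<^sub>R d"
    by (simp add: ta_def tb_def tc_def td_def cross2_def vec_eq_iff forall_2 algebra_simps)
  have in1: "u *\<^sub>R a + v *\<^sub>R b + w *\<^sub>R c \<in> quad_map V ` unit_square"
    if "u \<ge> 0" "v \<ge> 0" "w \<ge> 0" "u + v + w = 1" for u v w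
  proof -
    have "u = 1 - (v + w)" using that by simp
    then have "u *\<^sub>R a + v *\<^sub>R b + w *\<^sub>R c = quad_map V (v + w, w)"
      using that(2) by (simp add: Vq quad_map_barycentric_below)
    moreover have "(v + w, w) \<in> unit_square" using that by (auto simp: unit_square_def)
    ultimately show ?thesis by blast
  qed
  have in2: "u *\<^sub>R a + v *\<^sub>R c + w *\<^sub>R d \<in> quad_map V ` unit_square"
    if "u \<ge> 0" "v \<ge> 0" "w \<ge> 0" "u + v + w = 1" for u v w
  proof -
    have "u = 1 - (v + w)" using that by simp
    then have "u *\<^sub>R a + v *\<^sub>R c + w *\<^sub>R d = quad_map V (v, v + w)"
      using that(3) by (simp add: Vq quad_map_barycentric_above)
    moreover have "(v, v + w) \<in> unit_square" using that by (auto simp: unit_square_def)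
    ultimately show ?thesis by blast
  qed
  have "convex hull {a, b, c, d} \<subseteq> quad_map V ` unit_square"
  proof
    fix p assume "p \<in> convex hull {a, b, c, d}"
    then obtain t t1 p' where t: "0 \<le> t" "0 \<le> t1" "t + t1 = 1"
      and p': "p' \<in> convex hull {b, c, d}" "p = t *\<^sub>R a + t1 *\<^sub>R p'"
      unfolding convex_hull_insert[of "{b, c, d}" a, OF insert_not_empty] by blast
    then obtain s1 s2 s3 where s: "0 \<le> s1" "0 \<le> s2" "0 \<le> s3" "s1 + s2 + s3 = 1"
      and p: "p = t *\<^sub>R a + t1 *\<^sub>R (s1 *\<^sub>R b + s2 *\<^sub>R c + s3 *\<^sub>R d)"
      unfolding convex_hull_3 by blast
    define \<beta> \<gamma> \<delta> where "\<beta> = t1 * s1" and "\<gamma> = t1 * s2" and "\<delta> = t1 * s3"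
    have nn: "\<beta> \<ge> 0" "\<gamma> \<ge> 0" "\<delta> \<ge> 0" using t s by (simp_all add: \<beta>_def \<gamma>_def \<delta>_def)
    have "t1 * (s1 + s2 + s3) = t1" using s by simp
    then have total: "t + \<beta> + \<gamma> + \<delta> = 1"
      using t by (simp add: \<beta>_def \<gamma>_def \<delta>_def distrib_left)
    have p: "p = t *\<^sub>R a + \<beta> *\<^sub>R b + \<gamma> *\<^sub>R c + \<delta> *\<^sub>R d"
      by (simp add: p \<beta>_def \<gamma>_def \<delta>_def scaleR_add_right)
    show "p \<in> quad_map V ` unit_square"
    \<comment> \<open>The smaller ratio decides which of the weights on \<open>b\<close> and
      \<open>d\<close> reaches zero first, and hence which triangle contains
      \<open>p\<close>.\<close>
    proof (cases "\<beta> / tb \<le> \<delta> / td")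
      case True
      define l where "l = \<beta> / tb"
      have l: "l \<ge> 0" "l * tb = \<beta>" "l * td \<le> \<delta>"
        using True pos nn by (simp_all add: l_def field_simps)
      have "p = p + l *\<^sub>R ((ta *\<^sub>R a + tc *\<^sub>R c) - (tb *\<^sub>R b + td *\<^sub>R d))"
        unfolding rel by simp
      also have "\<dots> = (t + l * ta) *\<^sub>R a + (\<gamma> + l * tc) *\<^sub>R c + (\<delta> - l * td) *\<^sub>R d"
        by (simp add: p l(2)[symmetric] algebra_simps)
      also have "\<dots> \<in> quad_map V ` unit_square"
      proof (rule in2)
        have "l * (ta + tc) = l * (tb + td)" using sum by simp
        then show "t + l * ta + (\<gamma> + l * tc) + (\<delta> - l * td) = 1"
          using total l(2) by (simp add: algebra_simps)
      qed (use l t nn pos in auto)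
      finally show ?thesis .
    next
      case False
      define l where "l = \<delta> / td"
      have l: "l \<ge> 0" "l * td = \<delta>" "l * tb \<le> \<beta>"
        using False pos nn by (simp_all add: l_def field_simps)
      have "p = p + l *\<^sub>R ((ta *\<^sub>R a + tc *\<^sub>R c) - (tb *\<^sub>R b + td *\<^sub>R d))"
        unfolding rel by simp
      also have "\<dots> = (t + l * ta) *\<^sub>R a + (\<beta> - l * tb) *\<^sub>R b + (\<gamma> + l * tc) *\<^sub>R c"
        by (simp add: p l(2)[symmetric] algebra_simps)
      also have "\<dots> \<in> quad_map V ` unit_square"
      proof (rule in1)
        have "l * (ta + tc) = l * (tb + td)" using sum by simp
        then show "t + l * ta + (\<beta> - l * tb) + (\<gamma> + l * tc) = 1"
          using total l(2) by (simp add: algebra_simps)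
      qed (use l t nn pos in auto)
      finally show ?thesis .
    qed
  qed
  moreover have "quad_map V z \<in> convex hull {a, b, c, d}" if "z \<in> unit_square" for z
  proof -
    obtain x y where xy: "z = (x, y)" by (cases z)
    have bounds: "0 \<le> x" "x \<le> 1" "0 \<le> y" "y \<le> 1" using that by (auto simp: xy unit_square_def)
    show ?thesis
    proof (cases "y \<le> x")
      case True
      have "quad_map V z \<in> convex hull {a, b, c}"
        unfolding convex_hull_3 using True bounds
        by (intro CollectI exI[of _ "1 - x"] exI[of _ "x - y"] exI[of _ y])
          (simp add: Vq xy quad_map_barycentric_below)
      then show ?thesis using hull_mono[of "{a, b, c}" "{a, b, c, d}" convex] by blast
    next
      case False
      have "quad_map V z \<in> convex hull {a, c, d}"
        unfolding convex_hull_3 using False bounds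
        by (intro CollectI exI[of _ "1 - y"] exI[of _ x] exI[of _ "y - x"])
          (simp add: Vq xy quad_map_barycentric_above)
      then show ?thesis using hull_mono[of "{a, c, d}" "{a, b, c, d}" convex] by blast
    qed
  qed
  ultimately show ?thesis by (auto simp: quad_region_def Vq)
qed

section \<open>The quadrilaterals of the subdivision as grid cells\<close>

lemma lattice_point_barycentric_below:
  assumes "N > 0" "j \<le> i"
  shows "lattice_point (a, b, c, d) N (i, j) =
    (1 / real N) *\<^sub>R ((real N - real i) *\<^sub>R a + (real i - real j) *\<^sub>R b + real j *\<^sub>R c)"
proof -
  have "1 - real i / real N = (real N - real i) / real N"
    "real i / real N - real j / real N = (real i - real j) / real N"
    using assms by (simp_all add: field_simps)
  then show ?thesis
    using assms by (simp add: lattice_point_def quad_map_barycentric_below divide_right_mono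
      scaleR_add_right)
qed

lemma lattice_point_barycentric_above:
  assumes "N > 0" "i \<le> j"
  shows "lattice_point (a, b, c, d) N (i, j) =
    (1 / real N) *\<^sub>R ((real N - real j) *\<^sub>R a + real i *\<^sub>R c + (real j - real i) *\<^sub>R d)"
proof -
  have "1 - real j / real N = (real N - real j) / real N"
    "real j / real N - real i / real N = (real j - real i) / real N"
    using assms by (simp_all add: field_simps)
  then show ?thesis
    using assms by (simp add: lattice_point_def quad_map_barycentric_above divide_right_mono
      scaleR_add_right)
qed

text \<open>A point with coordinates \<open>al\<close> has parameters \<open>x\<close> = second plus
  third and \<open>y\<close> = third plus fourth coordinate, which explains the cell index. For
  indices in \<open>A3\<close> the cell straddles the diagonal, so both barycentric formulas are
  used.\<close>

lemma Sm_eq_cell_quad: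
  assumes m: "m > 0" and k: "(k1, k2, k3, k4) \<in> Aidx m"
  shows "Sm Q m (k1, k2, k3, k4) = cell_quad Q m (k2 + k3, k3 + k4)"
proof -
  obtain a b c d where Q: "Q = (a, b, c, d)" by (cases Q)
  consider "k4 = 0" "k2 \<noteq> 0" "m = Suc (k1 + k2 + k3)" | "k2 = 0" "k4 \<noteq> 0" "m = Suc (k1 + k3 + k4)"
    | "k2 = 0" "k4 = 0" "m = Suc (k1 + k3)"
    using k m by (auto simp: Aidx_def A1_def A2_def A3_def)
  then show ?thesis
  proof cases
    case 1
    then show ?thesis
      by (simp add: Q Sm_def Let_def A1_def cell_quad_lattice lattice_point_barycentric_below
          algebra_simps add_divide_distrib diff_divide_distrib)
  next
    case 2
    then show ?thesis
      by (simp add: Q Sm_def Let_def A1_def A2_def cell_quad_lattice lattice_point_barycentric_above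
          algebra_simps add_divide_distrib diff_divide_distrib)
  next
    case 3
    then show ?thesis
      by (simp add: Q Sm_def Let_def A1_def A2_def cell_quad_lattice lattice_point_barycentric_below
          lattice_point_barycentric_above
          algebra_simps add_divide_distrib diff_divide_distrib)
  qed
qed

text \<open>The inverse of the index change; truncated subtraction makes at most one of the second
  and fourth entries nonzero.\<close>

lemma Aidx_cell:
  assumes "i < m" "j < m"
  shows "(m - 1 - max i j, i - j, min i j, j - i) \<in> Aidx m"
  using assms by (cases i j rule: linorder_cases) (auto simp: Aidx_def A1_def A2_def A3_def)

lemma S_set_eq:
  assumes m: "m > 0"
  shows "S_set Q m = cell_quad Q m ` ({..<m} \<times> {..<m})"
proof
  show "S_set Q m \<subseteq> cell_quad Q m ` ({..<m} \<times> {..<m})"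
  proof
    fix W assume "W \<in> S_set Q m"
    then obtain k1 k2 k3 k4 where k: "(k1, k2, k3, k4) \<in> Aidx m" "W = Sm Q m (k1, k2, k3, k4)"
      unfolding S_set_def by auto
    then have "k2 + k3 < m \<and> k3 + k4 < m"
      using m by (auto simp: Aidx_def A1_def A2_def A3_def)
    then show "W \<in> cell_quad Q m ` ({..<m} \<times> {..<m})"
      using k Sm_eq_cell_quad[OF m k(1)] by auto
  qed
  show "cell_quad Q m ` ({..<m} \<times> {..<m}) \<subseteq> S_set Q m"
  proof
    fix W assume "W \<in> cell_quad Q m ` ({..<m} \<times> {..<m})"
    then obtain i j where ij: "i < m" "j < m" "W = cell_quad Q m (i, j)" by auto
    then have A: "(m - 1 - max i j, i - j, min i j, j - i) \<in> Aidx m" using Aidx_cell by simp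
    have "i - j + min i j = i" "min i j + (j - i) = j" by auto
    then have "W = Sm Q m (m - 1 - max i j, i - j, min i j, j - i)"
      using Sm_eq_cell_quad[OF m A] ij by simp
    then show "W \<in> S_set Q m" using A unfolding S_set_def by blast
  qed
qed

lemma lattice_point_eq_iff:
  assumes "convex_quad_ccw Q" "N > 0"
  shows "lattice_point Q N k = lattice_point Q N k' \<longleftrightarrow> k = k'"
  using inj_eq[OF inj_quad_map[OF assms(1)]] assms(2) by (simp add: lattice_point_def prod_eq_iff)

lemma cell_quad_eq_iff:
  assumes "convex_quad_ccw Q" "N > 0"
  shows "cell_quad Q N k = cell_quad Q N k' \<longleftrightarrow> k = k'"
proof
  assume "cell_quad Q N k = cell_quad Q N k'"
  then have "lattice_point Q N k = lattice_point Q N k'"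
    by (metis Pair_inject cell_quad_lattice surj_pair)
  then show "k = k'" using lattice_point_eq_iff[OF assms] by simp
qed simp

text \<open>Equal segments have the same pair of end points, and lattice points with different
  indices are different. A common side is therefore a common pair of lattice indices, and a
  comparison of indices remains.\<close>

lemma quad_adj_cell_quad:
  assumes Q: "convex_quad_ccw Q" and N: "N > 0"
  shows "quad_adj (cell_quad Q N k) (cell_quad Q N k') \<longleftrightarrow> cell_adj k k'"
proof -
  obtain i j where k: "k = (i, j)" by (cases k)
  obtain i' j' where k': "k' = (i', j')" by (cases k')
  have "quad_adj (cell_quad Q N k) (cell_quad Q N k') \<longleftrightarrow> (i, j) \<noteq> (i', j') \<and>
    {{(i, j), (Suc i, j)}, {(Suc i, j), (Suc i, Suc j)}, {(Suc i, Suc j), (i, Suc j)}, {(i, Suc j), (i, j)}} \<inter>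
    {{(i', j'), (Suc i', j')}, {(Suc i', j'), (Suc i', Suc j')}, {(Suc i', Suc j'), (i', Suc j')},
      {(i', Suc j'), (i', j')}} \<noteq> {}"
    unfolding quad_adj_def cell_quad_eq_iff[OF Q N]
    by (simp add: k k' cell_quad_lattice quad_sides_def doubleton_eq_iff lattice_point_eq_iff[OF Q N])
  also have "\<dots> \<longleftrightarrow> cell_adj k k'"
    unfolding k k' cell_adj_def by (auto simp: doubleton_eq_iff)
  finally show ?thesis .
qed

section \<open>The recursion for the labyrinth sets in grid coordinates\<close>

text \<open>In the parameter square \<open>Pmap\<close> for the cell \<open>k\<close> is just
  \<open>cell_map N k\<close>, so substituting a cell into a cell composes cell maps.\<close>

lemma Pquad_cell_quad:
  assumes Q: "convex_quad_ccw Q" and N: "N > 0" and m: "m > 0" and k': "fst k' < m" "snd k' < m"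
  shows "Pquad Q (cell_quad Q N k) (cell_quad Q m k') =
    cell_quad Q (N * m) (fst k * m + fst k', snd k * m + snd k')"
proof -
  have "Pmap Q (cell_quad Q N k) (quad_map Q (cell_map m k' z)) =
      quad_map Q (cell_map (N * m) (fst k * m + fst k', snd k * m + snd k') z)"
    if "z \<in> unit_square" for z
    using Pmap_quad_map[OF Q cell_map_in_unit_square[OF k' that]]
      quad_map_cell_quad[OF N cell_map_in_unit_square[OF k' that]]
      cell_map_compose[OF m, of N "fst k" "snd k" "fst k'" "snd k'" z]
    by simp
  then show ?thesis
    by (simp add: Pquad_def cell_quad_def corner_quad_def unit_square_def)
qed

lemma lab_W_cell_quad:
  assumes Q: "convex_quad_ccw Q" and m: "m > 0" and K: "K \<subseteq> {..<m} \<times> {..<m}"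
    and W: "W \<in> lab_W Q (cell_quad Q m ` K) n"
  shows "\<exists>k. W = cell_quad Q (m ^ Suc n) k"
  using W
proof (induction n arbitrary: W)
  case (Suc n)
  then obtain W' k' where W: "W = Pquad Q W' (cell_quad Q m k')" "k' \<in> K"
    "W' \<in> lab_W Q (cell_quad Q m ` K) n" by auto
  obtain k where k: "W' = cell_quad Q (m ^ Suc n) k" using Suc.IH[OF W(3)] by blast
  have "fst k' < m" "snd k' < m" using K W(2) by auto
  then have "W = cell_quad Q (m ^ Suc n * m) (fst k * m + fst k', snd k * m + snd k')"
    unfolding W(1) k using m by (intro Pquad_cell_quad[OF Q]) simp_all
  then show ?case by (metis power_Suc2)
qed auto

context square_labyrinth
begin

lemma quad_map_Pquad:
  assumes Q: "convex_quad_ccw Q" and W: "W \<in> lab_W Q (cell_quad Q m ` K) n"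
    and k: "k \<in> K" and z: "z \<in> unit_square"
  shows "quad_map (Pquad Q W (cell_quad Q m k)) z = quad_map W (cell_map m k z)"
proof -
  have m0: "m > 0" using m by simp
  obtain k' where k': "W = cell_quad Q (m ^ Suc n) k'"
    using lab_W_cell_quad[OF Q m0 K W] by blast
  have N: "m ^ Suc n > 0" using m0 by simp
  have N': "m ^ Suc n * m > 0" using m0 by simp
  show ?thesis
    unfolding k' Pquad_cell_quad[OF Q N m0 K_less[OF k]] quad_map_cell_quad[OF N' z]
      quad_map_cell_quad[OF N cell_map_in_unit_square[OF K_less[OF k] z]]
    using cell_map_compose[OF m0, of "m ^ Suc n" "fst k'" "snd k'" "fst k" "snd k" z] by simp
qed

text \<open>Passing to the next level replaces \<open>X\<close> by \<open>refine X\<close> inside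
  the maps of the old level. Hence the induction generalises \<open>X\<close> and splits off the
  innermost refinement.\<close>

lemma quad_map_lab_W:
  assumes Q: "convex_quad_ccw Q" and X: "X \<subseteq> unit_square"
  shows "(\<Union>W\<in>lab_W Q (cell_quad Q m ` K) n. quad_map W ` X) = quad_map Q ` (refine ^^ Suc n) X"
  using X
proof (induction n arbitrary: X)
  case 0
  have "quad_map (cell_quad Q m k) ` X = quad_map Q ` cell_map m k ` X" for k
    unfolding image_image using m 0 by (intro image_cong refl quad_map_cell_quad) auto
  then show ?case by (simp add: refine_def image_UN)
next
  case (Suc n)
  let ?L = "lab_W Q (cell_quad Q m ` K)"
  have "refine X \<subseteq> unit_square"
    using refine_mono[OF Suc.prems] refine_unit_square by blast
  have "(\<Union>W\<in>?L (Suc n). quad_map W ` X) =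
      (\<Union>W\<in>?L n. \<Union>k\<in>K. quad_map (Pquad Q W (cell_quad Q m k)) ` X)"
  proof -
    have "?L (Suc n) = (\<Union>W\<in>?L n. (\<lambda>k. Pquad Q W (cell_quad Q m k)) ` K)"
      unfolding lab_W.simps by blast
    then show ?thesis by (simp only: UN_UN_flatten image_image SUP_image comp_def)
  qed
  also have "\<dots> = (\<Union>W\<in>?L n. \<Union>k\<in>K. quad_map W ` cell_map m k ` X)"
    unfolding image_image using Suc.prems
    by (intro SUP_cong refl image_cong quad_map_Pquad[OF Q]) auto
  also have "\<dots> = (\<Union>W\<in>?L n. quad_map W ` refine X)"
    by (simp add: refine_def image_UN)
  also have "\<dots> = quad_map Q ` (refine ^^ Suc n) (refine X)"
    by (rule Suc.IH) fact
  also have "(refine ^^ Suc n) (refine X) = (refine ^^ Suc (Suc n)) X"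
    by (simp only: funpow_Suc_right comp_apply)
  finally show ?case .
qed

text \<open>Level by level the regions are images of refined squares, and injectivity of
  \<open>quad_map Q\<close> lets the image commute with the intersection.\<close>

lemma lab_fractal_eq:
  assumes Q: "convex_quad_ccw Q"
  shows "lab_fractal Q (cell_quad Q m ` K) = quad_map Q ` fractal"
proof -
  have m0: "m > 0" using m by simp
  have "quad_region W = quad_map W ` unit_square" if W: "W \<in> lab_W Q (cell_quad Q m ` K) n" for W n
  proof (rule quad_region_eq)
    obtain k where "W = cell_quad Q (m ^ Suc n) k"
      using lab_W_cell_quad[OF Q m0 K W] by blast
    then show "convex_quad_ccw W" using convex_cell_quad[OF _ Q] m by simp
  qed
  then have "lab_L Q (cell_quad Q m ` K) n = quad_map Q ` (refine ^^ Suc n) unit_square" for n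
    unfolding lab_L_def quad_map_lab_W[OF Q subset_refl, symmetric] by (intro SUP_cong refl) auto
  then have "lab_fractal Q (cell_quad Q m ` K) = (\<Inter>n. quad_map Q ` (refine ^^ Suc n) unit_square)"
    by (simp only: lab_fractal_def)
  also have "\<dots> = quad_map Q ` (\<Inter>n. (refine ^^ Suc n) unit_square)"
    using image_INT[OF inj_quad_map[OF Q], of UNIV "\<lambda>n. (refine ^^ Suc n) unit_square"] by auto
  finally show ?thesis unfolding fractal_eq_Suc .
qed

text \<open>With the quadrilaterals as indices the tree property is used as given;
  \<open>inv_into\<close> recovers the cell of a quadrilateral.\<close>

lemma tree_ifs_fractal:
  assumes Q: "convex_quad_ccw Q" and tree: "graph_tree (cell_quad Q m ` K) quad_adj"
  shows "tree_ifs fractal (cell_quad Q m ` K) (\<lambda>W. cell_map m (inv_into K (cell_quad Q m) W))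
    (1 / real m) quad_adj"
proof -
  have m0: "m > 0" using m by simp
  have "inj_on (cell_quad Q m) K" using cell_quad_eq_iff[OF Q m0] by (auto intro: inj_onI)
  then have inv: "inv_into K (cell_quad Q m) (cell_quad Q m k) = k" if "k \<in> K" for k
    using that by simp
  note adj = quad_adj_cell_quad[OF Q m0]
  show ?thesis
  proof
    have "(\<Union>W\<in>cell_quad Q m ` K. cell_map m (inv_into K (cell_quad Q m) W) ` fractal) =
        (\<Union>k\<in>K. cell_map m k ` fractal)"
      by (simp add: inv)
    then show "fractal = (\<Union>W\<in>cell_quad Q m ` K. cell_map m (inv_into K (cell_quad Q m) W) ` fractal)"
      using fractal_cell by simp
  next
    fix V W :: quad assume "quad_adj V W"
    then show "quad_adj W V" by (auto simp: quad_adj_def)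
  next
    fix V W assume VW: "V \<in> cell_quad Q m ` K" "W \<in> cell_quad Q m ` K"
    then obtain k l where kl: "k \<in> K" "l \<in> K" "V = cell_quad Q m k" "W = cell_quad Q m l" by blast
    let ?A = "cell_map m (inv_into K (cell_quad Q m) V) ` fractal"
    let ?B = "cell_map m (inv_into K (cell_quad Q m) W) ` fractal"
    have AB: "?A = cell_map m k ` fractal" "?B = cell_map m l ` fractal"
      using kl inv by simp_all
    show "?A \<inter> ?B \<noteq> {}" if "quad_adj V W"
      unfolding AB using adj_cells_meet that adj kl by simp
    assume "V \<noteq> W"
    then have ne: "k \<noteq> l" using kl by auto
    show "quad_adj V W" if "?A \<inter> ?B \<noteq> {}"
      using cells_meet_imp_adj[OF ne that[unfolded AB]] adj kl by simp
    show "x = y" if "x \<in> ?A \<inter> ?B" "y \<in> ?A \<inter> ?B" for x y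
      using cells_meet_unique[OF ne that[unfolded AB]] .
  qed (use m tree compact_fractal dist_cell_map in auto)
qed

end

section \<open>From labyrinth sets in a quadrilateral to patterns in the square\<close>

lemma ex1_pairE:
  assumes "\<exists>!p. case p of (x, y) \<Rightarrow> P x y"
  obtains x y where "P x y" "\<And>x' y'. P x' y' \<Longrightarrow> x' = x \<and> y' = y"
proof -
  obtain p where p: "case p of (x, y) \<Rightarrow> P x y" "\<And>q. (case q of (x, y) \<Rightarrow> P x y) \<Longrightarrow> q = p"
    using assms by (elim ex1E) blast
  show ?thesis
  proof (rule that)
    show "P (fst p) (snd p)" using p(1) by (simp add: case_prod_beta)
    show "x' = fst p \<and> y' = snd p" if "P x' y'" for x' y'
      using p(2)[of "(x', y')"] that by auto
  qed
qed

theorem theorem4p1: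
  fixes Q :: quad and m :: nat and W1 :: "quad set"
  assumes "4 \<le> m"
    and "convex_quad_ccw Q"
    and "shorter_diag_13 Q"
    and "quad_labyrinth_set Q m W1"
  shows "dendrite (lab_fractal Q W1)"
proof -
  have m: "m > 0" using assms(1) by simp
  note Q = assms(2)
  define K where "K = {k \<in> {..<m} \<times> {..<m}. cell_quad Q m k \<in> W1}"
  have lab: "W1 \<subseteq> S_set Q m" "graph_tree W1 quad_adj"
    using assms(4) by (simp_all add: quad_labyrinth_set_def)
  have W1: "W1 = cell_quad Q m ` K"
    using lab(1) unfolding S_set_eq[OF m] K_def by blast
  \<comment> \<open>Under the index change these are the cells of column \<open>i\<close> in the
    bottom and the top row.\<close>
  have vert: "(m - 1 - i, i, 0, 0) \<in> Aidx m \<and> Sm Q m (m - 1 - i, i, 0, 0) \<in> W1 \<and>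
      (0, 0, i, m - 1 - i) \<in> Aidx m \<and> Sm Q m (0, 0, i, m - 1 - i) \<in> W1 \<longleftrightarrow>
      (i, 0) \<in> K \<and> (i, m - 1) \<in> K" if "i < m" for i
  proof -
    have A: "(m - 1 - i, i, 0, 0) \<in> Aidx m" "(0, 0, i, m - 1 - i) \<in> Aidx m"
      using that by (auto simp: Aidx_def A1_def A2_def A3_def)
    then show ?thesis
      using that Sm_eq_cell_quad[OF m A(1)] Sm_eq_cell_quad[OF m A(2)] by (auto simp: K_def)
  qed
  \<comment> \<open>Here the two cells are those of row \<open>j\<close> in the leftmost and the
    rightmost column.\<close>
  have horiz: "(m - 1 - j, 0, 0, j) \<in> Aidx m \<and> Sm Q m (m - 1 - j, 0, 0, j) \<in> W1 \<and>
      (0, m - 1 - j, j, 0) \<in> Aidx m \<and> Sm Q m (0, m - 1 - j, j, 0) \<in> W1 \<longleftrightarrow>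
      (0, j) \<in> K \<and> (m - 1, j) \<in> K" if "j < m" for j
  proof -
    have A: "(m - 1 - j, 0, 0, j) \<in> Aidx m" "(0, m - 1 - j, j, 0) \<in> Aidx m"
      using that by (auto simp: Aidx_def A1_def A2_def A3_def)
    then show ?thesis
      using that Sm_eq_cell_quad[OF m A(1)] Sm_eq_cell_quad[OF m A(2)] by (auto simp: K_def)
  qed
  \<comment> \<open>The entries of an exit index add up to \<open>m - 1\<close>, so uniqueness of
    the pair amounts to uniqueness of the column or row.\<close>
  have vsum: "k2 < m \<and> k1 = m - 1 - k2" if "(k1, k2, 0, 0) \<in> Aidx m" for k1 k2
    using that m by (auto simp: Aidx_def A1_def A2_def A3_def)
  have hsum: "k4 < m \<and> k1 = m - 1 - k4" if "(k1, 0, 0, k4) \<in> Aidx m" for k1 k4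
    using that m by (auto simp: Aidx_def A1_def A2_def A3_def)
  have K_lt: "i < m \<and> j < m" if "(i, j) \<in> K" for i j using that by (simp add: K_def)
  have exV: "\<exists>!p. case p of (k1, k2) \<Rightarrow>
      (k1, k2, 0, 0) \<in> Aidx m \<and> Sm Q m (k1, k2, 0, 0) \<in> W1 \<and>
      (0, 0, k2, k1) \<in> Aidx m \<and> Sm Q m (0, 0, k2, k1) \<in> W1"
    and exH: "\<exists>!p. case p of (k1, k4) \<Rightarrow>
      (k1, 0, 0, k4) \<in> Aidx m \<and> Sm Q m (k1, 0, 0, k4) \<in> W1 \<and>
      (0, k1, k4, 0) \<in> Aidx m \<and> Sm Q m (0, k1, k4, 0) \<in> W1"
    using assms(4) unfolding quad_labyrinth_set_def by blast+
  obtain s where s: "(s, 0) \<in> K" "(s, m - 1) \<in> K" and s_unique: "\<And>i. (i, 0) \<in> K \<Longrightarrow> (i, m - 1) \<in> K \<Longrightarrow> i = s"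
  proof -
    obtain k1 k2 where k: "(k1, k2, 0, 0) \<in> Aidx m \<and> Sm Q m (k1, k2, 0, 0) \<in> W1 \<and>
        (0, 0, k2, k1) \<in> Aidx m \<and> Sm Q m (0, 0, k2, k1) \<in> W1"
      and unique: "\<And>k1' k2'. (k1', k2', 0, 0) \<in> Aidx m \<and> Sm Q m (k1', k2', 0, 0) \<in> W1 \<and>
        (0, 0, k2', k1') \<in> Aidx m \<and> Sm Q m (0, 0, k2', k1') \<in> W1 \<Longrightarrow> k1' = k1 \<and> k2' = k2"
      by (rule ex1_pairE[OF exV]) (rule that)
    have k2: "k2 < m" "k1 = m - 1 - k2" using vsum k by blast+
    have "i = k2" if i: "(i, 0) \<in> K" "(i, m - 1) \<in> K" for i
      using unique[of "m - 1 - i" i] vert[of i] i K_lt[OF i(1)] by blast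
    then show ?thesis using that[of k2] vert[OF k2(1)] k unfolding k2(2) by blast
  qed
  obtain r where r: "(0, r) \<in> K" "(m - 1, r) \<in> K" and r_unique: "\<And>j. (0, j) \<in> K \<Longrightarrow> (m - 1, j) \<in> K \<Longrightarrow> j = r"
  proof -
    obtain k1 k4 where k: "(k1, 0, 0, k4) \<in> Aidx m \<and> Sm Q m (k1, 0, 0, k4) \<in> W1 \<and>
        (0, k1, k4, 0) \<in> Aidx m \<and> Sm Q m (0, k1, k4, 0) \<in> W1"
      and unique: "\<And>k1' k4'. (k1', 0, 0, k4') \<in> Aidx m \<and> Sm Q m (k1', 0, 0, k4') \<in> W1 \<and>
        (0, k1', k4', 0) \<in> Aidx m \<and> Sm Q m (0, k1', k4', 0) \<in> W1 \<Longrightarrow> k1' = k1 \<and> k4' = k4"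
      by (rule ex1_pairE[OF exH]) (rule that)
    have k4: "k4 < m" "k1 = m - 1 - k4" using hsum k by blast+
    have "j = k4" if j: "(0, j) \<in> K" "(m - 1, j) \<in> K" for j
      using unique[of "m - 1 - j" j] horiz[of j] j K_lt[OF j(1)] by blast
    then show ?thesis using that[of k4] horiz[OF k4(1)] k unfolding k4(2) by blast
  qed
  \<comment> \<open>These indices become the cells \<open>(0, 0)\<close>,
    \<open>(m - 1, m - 1)\<close>, \<open>(m - 1, 0)\<close> and \<open>(0, m - 1)\<close>, in this
    order.\<close>
  have corner_idx: "(m - 1, 0, 0, 0) \<in> Aidx m" "(0, 0, m - 1, 0) \<in> Aidx m"
    "(0, m - 1, 0, 0) \<in> Aidx m" "(0, 0, 0, m - 1) \<in> Aidx m"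
    by (auto simp: Aidx_def A1_def A2_def A3_def)
  interpret square_labyrinth m K r s
  proof
    show "\<not> ((0, 0) \<in> K \<and> (m - 1, m - 1) \<in> K)" "\<not> ((m - 1, 0) \<in> K \<and> (0, m - 1) \<in> K)"
      using assms(4) corner_idx[THEN Sm_eq_cell_quad[OF m], of Q]
      unfolding quad_labyrinth_set_def by (auto simp: K_def)
    show "2 \<le> m" using assms(1) by simp
    show "K \<subseteq> {..<m} \<times> {..<m}" by (auto simp: K_def)
  qed (fact r s r_unique s_unique)+
  show ?thesis
    unfolding W1 lab_fractal_eq[OF Q]
  proof (rule dendrite_injective_image[OF tree_ifs_fractal[OF Q]])
    show "graph_tree (cell_quad Q m ` K) quad_adj" using lab(2) unfolding W1 .
    show "fractal \<noteq> {}" using exits_in_fractal by blast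
    show "inj_on (quad_map Q) fractal" using inj_quad_map[OF Q] inj_on_subset by blast
  qed (rule continuous_quad_map)
qed

end
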